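(* Let $(A,\mathfrak{m})$ be a Noetherian local ring with $\operatorname{depth} A\geq 2$. Let $I$ be an $\mathfrak{m}$-primary Ratliff-Rush closed ideal and assume that $I$ is asymptotically normal. If $x$ is $A$-superficial with respect to $I$, then $I/(x)$ is a Ratliff-Rush closed ideal of $A/(x)$.
   Context: For an ideal $J$ of a ring $B$, $\widetilde{J} = \bigcup_{j\geq 0}(J^{j+1}:_B J^j)$; $J$ is Ratliff-Rush closed if $\widetilde{J}=J$. $I$ is asymptotically normal if $I^n$ is integrally closed for all $n\gg 0$. An element $x\in I$ is $A$-superficial with respect to $I$ if there is $c\geq 0$ such that $(I^{n+1}:_A x)\cap I^c = I^n$ for all $n\geq c$. *)

theory Defs
  imports "HOL-Algebra.Algebra" "HOL-Library.Extended_Nat"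
begin

locale noetherian_local_ring = cring R + noetherian_ring R
  for R (structure) and M +
  assumes maximal: "maximalideal M R"
    and maximal_unique: "maximalideal N R \<Longrightarrow> N = M"

text \<open>
  Powers are taken in the commutative monoid of ideals, whose unit is the whole ring; thus
  \<open>J\<^sup>0\<close> is the carrier.
\<close>

abbreviation ideal_pow :: "('a, 'b) ring_scheme \<Rightarrow> 'a set \<Rightarrow> nat \<Rightarrow> 'a set"
  where "ideal_pow R J n \<equiv> J [^]\<^bsub>ideals_set R\<^esub> n"

text \<open>The colon \<open>(J :\<^sub>R K)\<close>; the colon \<open>(J :\<^sub>R x)\<close> by an element is the case \<open>K = {x}\<close>.\<close>

definition ideal_colon :: "('a, 'b) ring_scheme \<Rightarrow> 'a set \<Rightarrow> 'a set \<Rightarrow> 'a set"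
  where "ideal_colon R J K = {a \<in> carrier R. \<forall>k\<in>K. a \<otimes>\<^bsub>R\<^esub> k \<in> J}"

definition ratliff_rush_closure :: "('a, 'b) ring_scheme \<Rightarrow> 'a set \<Rightarrow> 'a set"
  where "ratliff_rush_closure R J =
    (\<Union>j. ideal_colon R (ideal_pow R J (j + 1)) (ideal_pow R J j))"

definition ratliff_rush_closed :: "('a, 'b) ring_scheme \<Rightarrow> 'a set \<Rightarrow> bool"
  where "ratliff_rush_closed R J \<longleftrightarrow> ratliff_rush_closure R J = J"

definition ideal_radical :: "('a, 'b) ring_scheme \<Rightarrow> 'a set \<Rightarrow> 'a set"
  where "ideal_radical R J = {a \<in> carrier R. \<exists>n::nat. a [^]\<^bsub>R\<^esub> n \<in> J}"

definition primary_ideal :: "('a, 'b) ring_scheme \<Rightarrow> 'a set \<Rightarrow> bool"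
  where "primary_ideal R Q \<longleftrightarrow> ideal Q R \<and> Q \<noteq> carrier R \<and>
    (\<forall>a\<in>carrier R. \<forall>b\<in>carrier R. a \<otimes>\<^bsub>R\<^esub> b \<in> Q \<longrightarrow> a \<in> Q \<or> (\<exists>n::nat. b [^]\<^bsub>R\<^esub> n \<in> Q))"

definition primary_to :: "('a, 'b) ring_scheme \<Rightarrow> 'a set \<Rightarrow> 'a set \<Rightarrow> bool"
  where "primary_to R P Q \<longleftrightarrow> primary_ideal R Q \<and> ideal_radical R Q = P"

text \<open>
  A sequence \<open>x\<^sub>0, \<dots>, x\<^sub>r\<close> is regular if each \<open>x\<^sub>i\<close> is a nonzerodivisor on
  \<open>R/(x\<^sub>0, \<dots>, x\<^bsub>i-1\<^esub>)\<close> (spelled out on representatives) and \<open>(x\<^sub>0, \<dots>, x\<^sub>r) \<noteq> R\<close>.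
\<close>

definition regular_sequence :: "('a, 'b) ring_scheme \<Rightarrow> 'a list \<Rightarrow> bool"
  where "regular_sequence R xs \<longleftrightarrow> set xs \<subseteq> carrier R \<and>
    (\<forall>i<length xs. \<forall>a\<in>carrier R.
       xs ! i \<otimes>\<^bsub>R\<^esub> a \<in> Idl\<^bsub>R\<^esub> (set (take i xs)) \<longrightarrow> a \<in> Idl\<^bsub>R\<^esub> (set (take i xs))) \<and>
    Idl\<^bsub>R\<^esub> (set xs) \<noteq> carrier R"

text \<open>For a local ring, \<open>M\<close> is the maximal ideal.\<close>

definition ring_depth :: "('a, 'b) ring_scheme \<Rightarrow> 'a set \<Rightarrow> enat"
  where "ring_depth R M =
    (SUP xs \<in> {xs. regular_sequence R xs \<and> set xs \<subseteq> M}. enat (length xs))"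

text \<open>Solutions \<open>a\<close> of equations \<open>a\<^sup>n + c\<^sub>1 a\<^bsup>n-1\<^esup> + \<dots> + c\<^sub>n = 0\<close> with \<open>n \<ge> 1\<close> and \<open>c\<^sub>i \<in> J\<^sup>i\<close>.\<close>

definition ideal_integral_closure :: "('a, 'b) ring_scheme \<Rightarrow> 'a set \<Rightarrow> 'a set"
  where "ideal_integral_closure R J = {a \<in> carrier R. \<exists>n\<ge>1. \<exists>c.
    (\<forall>i\<in>{1..n}. c i \<in> ideal_pow R J i) \<and>
    a [^]\<^bsub>R\<^esub> n \<oplus>\<^bsub>R\<^esub> (\<Oplus>\<^bsub>R\<^esub>i\<in>{1..n}. c i \<otimes>\<^bsub>R\<^esub> a [^]\<^bsub>R\<^esub> (n - i)) = \<zero>\<^bsub>R\<^esub>}"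

definition integrally_closed_ideal :: "('a, 'b) ring_scheme \<Rightarrow> 'a set \<Rightarrow> bool"
  where "integrally_closed_ideal R J \<longleftrightarrow> ideal_integral_closure R J = J"

definition asymptotically_normal :: "('a, 'b) ring_scheme \<Rightarrow> 'a set \<Rightarrow> bool"
  where "asymptotically_normal R J \<longleftrightarrow>
    (\<exists>N. \<forall>n\<ge>N. integrally_closed_ideal R (ideal_pow R J n))"

definition superficial :: "('a, 'b) ring_scheme \<Rightarrow> 'a set \<Rightarrow> 'a \<Rightarrow> bool"
  where "superficial R J x \<longleftrightarrow> x \<in> J \<and>
    (\<exists>c. \<forall>n\<ge>c. ideal_colon R (ideal_pow R J (n + 1)) {x} \<inter> ideal_pow R J c = ideal_pow R J n)"

text \<open>The image of \<open>J\<close> in \<open>R Quot K\<close>, that is \<open>J/K\<close> when \<open>K \<subseteq> J\<close>.\<close>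

definition quot_image :: "('a, 'b) ring_scheme \<Rightarrow> 'a set \<Rightarrow> 'a set \<Rightarrow> 'a set set"
  where "quot_image R K J = (\<lambda>a. K +>\<^bsub>R\<^esub> a) ` J"

end

theory Submission
  imports Defs
begin

text \<open>
  It suffices that \<open>a I\<^sup>n \<subseteq> I\<^bsup>n+1\<^esup> + xA\<close> implies \<open>a \<in> I\<close>. Let \<open>D(h, r)\<close> be the ideal of all \<open>z\<close> with
  \<open>z I\<^sup>n \<subseteq> x\<^sup>r A + I\<^bsup>n+h\<^esup>\<close> for some \<open>n\<close>, so that \<open>a \<in> D(1, 1)\<close>. Since \<open>A/(x)\<close> has positive depth,
  there is a constant \<open>h\<^sub>0\<close> with \<open>D(h, r) \<subseteq> x\<^sup>r A + I\<^sup>h\<close> whenever \<open>h \<ge> r + h\<^sub>0\<close>.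

  If \<open>z \<in> D(h, r)\<close> for all \<open>r\<close>, then \<open>z\<^sup>j \<in> D(jh, jh - h\<^sub>0) \<subseteq> I\<^bsup>jh-h\<^sub>0\<^esup>\<close> for all \<open>j\<close>, so \<open>z\<close> is integral over
  \<open>I\<^sup>h\<close>. For large \<open>h\<close> the ideal \<open>I\<^sup>h\<close> is integrally closed and \<open>A/I\<^sup>h\<close> is Artinian, hence \<open>D(h, r) = I\<^sup>h\<close>
  for all large \<open>r\<close>; peeling off factors of \<open>x\<close> gives a constant \<open>d\<close> with \<open>D(j - d, j) \<subseteq> I\<^bsup>j-d\<^esup>\<close>
  for large \<open>j\<close>.

  Expanding \<open>(a u)\<^sup>j\<close> with \<open>a u = x b + v\<close>, \<open>v \<in> I\<^bsup>m+1\<^esup>\<close>, for \<open>u \<in> I\<^sup>m\<close> shows that \<open>a\<^sup>l \<in> I\<^bsup>l-d\<^esup>\<close> for all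
  \<open>l < j\<close> implies \<open>a\<^sup>j \<in> D(j - d, j)\<close>. By induction \<open>a\<^sup>j \<in> I\<^bsup>j-d\<^esup>\<close> for all \<open>j\<close>. Therefore \<open>a w\<close> is integral
  over \<open>I\<^bsup>n+1\<^esup>\<close> for every \<open>w \<in> I\<^sup>n\<close>, which for large \<open>n\<close> yields \<open>a I\<^sup>n \<subseteq> I\<^bsup>n+1\<^esup>\<close>, and \<open>a \<in> I\<close> because
  \<open>I\<close> is Ratliff-Rush closed.
\<close>

no_notation Sum_Type.Plus (infixr \<open><+>\<close> 65)

section \<open>Ideal arithmetic\<close>

context cring
begin

lemma ideal_in_carrier: "ideal J R \<Longrightarrow> J \<subseteq> carrier R"
  by (rule additive_subgroup.a_subset[OF ideal.axioms(1)])

lemma idealI_cring: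
  assumes "J \<subseteq> carrier R" "\<zero> \<in> J"
    and "\<And>a b. a \<in> J \<Longrightarrow> b \<in> J \<Longrightarrow> a \<oplus> b \<in> J"
    and "\<And>a r. a \<in> J \<Longrightarrow> r \<in> carrier R \<Longrightarrow> r \<otimes> a \<in> J"
  shows "ideal J R"
proof (rule idealI[OF ring_axioms])
  have "\<ominus> a \<in> J" if "a \<in> J" for a
    using assms(1) assms(4)[of a "\<ominus> \<one>"] that by (metis a_inv_closed l_minus l_one one_closed subsetD)
  then show "subgroup J (add_monoid R)"
    using assms by (intro subgroup.intro) (auto simp flip: a_inv_def)
  show "a \<in> J \<Longrightarrow> r \<in> carrier R \<Longrightarrow> r \<otimes> a \<in> J" for a r
    by (rule assms(4))
  then show "a \<in> J \<Longrightarrow> r \<in> carrier R \<Longrightarrow> a \<otimes> r \<in> J" for a r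
    using assms(1) by (metis m_comm subsetD)
qed

lemma ideal_closed:
  assumes "ideal J R"
  shows ideal_zero: "\<zero> \<in> J"
    and ideal_add: "a \<in> J \<Longrightarrow> b \<in> J \<Longrightarrow> a \<oplus> b \<in> J"
    and ideal_minus: "a \<in> J \<Longrightarrow> b \<in> J \<Longrightarrow> a \<ominus> b \<in> J"
    and ideal_uminus: "a \<in> J \<Longrightarrow> \<ominus> a \<in> J"
    and ideal_lmult: "a \<in> J \<Longrightarrow> r \<in> carrier R \<Longrightarrow> r \<otimes> a \<in> J"
    and ideal_rmult: "a \<in> J \<Longrightarrow> r \<in> carrier R \<Longrightarrow> a \<otimes> r \<in> J"
proof -
  interpret J: ideal J R by fact
  show "\<zero> \<in> J" "a \<in> J \<Longrightarrow> b \<in> J \<Longrightarrow> a \<oplus> b \<in> J" "a \<in> J \<Longrightarrow> b \<in> J \<Longrightarrow> a \<ominus> b \<in> J"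
    "a \<in> J \<Longrightarrow> \<ominus> a \<in> J"
    "a \<in> J \<Longrightarrow> r \<in> carrier R \<Longrightarrow> r \<otimes> a \<in> J" "a \<in> J \<Longrightarrow> r \<in> carrier R \<Longrightarrow> a \<otimes> r \<in> J"
    by (auto simp: a_minus_def J.I_l_closed J.I_r_closed)
qed

lemma ideal_diff_cancel:
  assumes "ideal J R" "a \<in> carrier R" "b \<in> J" "a \<ominus> b \<in> J"
  shows "a \<in> J"
proof -
  have "b \<in> carrier R" using assms ideal.Icarr by metis
  then have "a = (a \<ominus> b) \<oplus> b" using assms(2) by algebra
  then show ?thesis using assms ideal_add by metis
qed

lemma ideal_prod_subset_iff:
  assumes "ideal K R"
  shows "J \<cdot> J' \<subseteq> K \<longleftrightarrow> (\<forall>a\<in>J. \<forall>b\<in>J'. a \<otimes> b \<in> K)"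
proof
  assume *: "\<forall>a\<in>J. \<forall>b\<in>J'. a \<otimes> b \<in> K"
  show "J \<cdot> J' \<subseteq> K"
  proof
    fix s assume "s \<in> J \<cdot> J'"
    then show "s \<in> K"
      by (induct s rule: ideal_prod.induct) (use * ideal_add[OF assms] in auto)
  qed
qed (auto intro: ideal_prod.prod)

lemma ideal_prod_mono:
  assumes "J \<subseteq> K" "J' \<subseteq> K'"
  shows "J \<cdot> J' \<subseteq> K \<cdot> K'"
proof
  fix s assume "s \<in> J \<cdot> J'"
  then show "s \<in> K \<cdot> K'"
    by (induct s rule: ideal_prod.induct) (use assms in \<open>auto intro: ideal_prod.intros\<close>)
qed

lemma mem_set_add_iff: "s \<in> J <+> K \<longleftrightarrow> (\<exists>a\<in>J. \<exists>b\<in>K. s = a \<oplus> b)"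
  by (auto simp: set_add_def')

lemma set_addI: "a \<in> J \<Longrightarrow> b \<in> K \<Longrightarrow> a \<oplus> b \<in> J <+> K"
  by (auto simp: set_add_def')

lemma set_add_upper:
  assumes "ideal J R" "ideal K R"
  shows "J \<subseteq> J <+> K" "K \<subseteq> J <+> K"
proof -
  show "J \<subseteq> J <+> K"
  proof
    fix a assume "a \<in> J"
    then show "a \<in> J <+> K"
      using set_addI[of a J \<zero> K] ideal_zero[OF assms(2)] ideal.Icarr[OF assms(1)] by simp
  qed
  show "K \<subseteq> J <+> K"
  proof
    fix a assume "a \<in> K"
    then show "a \<in> J <+> K"
      using set_addI[of \<zero> J a K] ideal_zero[OF assms(1)] ideal.Icarr[OF assms(2)] by simp
  qed
qed

lemma set_add_least:
  assumes "ideal L R" "J \<subseteq> L" "K \<subseteq> L"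
  shows "J <+> K \<subseteq> L"
proof
  fix s assume "s \<in> J <+> K"
  then obtain a b where "a \<in> J" "b \<in> K" "s = a \<oplus> b" by (auto simp: mem_set_add_iff)
  then show "s \<in> L" using assms(2,3) ideal_add[OF assms(1)] by blast
qed

lemma set_add_mono: "J \<subseteq> J' \<Longrightarrow> K \<subseteq> K' \<Longrightarrow> J <+> K \<subseteq> J' <+> K'"
  by (fastforce simp: mem_set_add_iff)

lemma mem_cgenideal_iff: "x \<in> carrier R \<Longrightarrow> z \<in> PIdl x \<longleftrightarrow> (\<exists>b\<in>carrier R. z = x \<otimes> b)"
  by (auto simp: cgenideal_def m_comm)

lemma cgenideal_subset_iff: "ideal J R \<Longrightarrow> x \<in> carrier R \<Longrightarrow> PIdl x \<subseteq> J \<longleftrightarrow> x \<in> J"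
  using cgenideal_minimal cgenideal_self by blast

section \<open>Powers of ideals\<close>

lemma ideals_set_one [simp]: "\<one>\<^bsub>ideals_set R\<^esub> = carrier R"
  by (simp add: ideals_set_def)

lemma ideal_pow_0: "ideal_pow R J 0 = carrier R"
  by simp

lemma ideal_pow_Suc: "ideal_pow R J (Suc n) = ideal_pow R J n \<cdot> J"
  by (simp add: ideals_set_def)

lemma ideal_pow_ideal [simp, intro]: "ideal J R \<Longrightarrow> ideal (ideal_pow R J n) R"
  by (induct n) (simp_all only: ideal_pow_0 ideal_pow_Suc oneideal ideal_prod_is_ideal)

lemma ideal_pow_1 [simp]: "ideal J R \<Longrightarrow> ideal_pow R J (Suc 0) = J"
  by (simp only: ideal_pow_Suc ideal_pow_0 ideal_prod_commute[OF oneideal] ideal_prod_one)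

lemma ideal_pow_add:
  assumes "ideal J R"
  shows "ideal_pow R J (m + n) = ideal_pow R J m \<cdot> ideal_pow R J n"
proof -
  interpret S: comm_monoid "ideals_set R" by (rule ideals_set_is_comm_monoid)
  have "J \<in> carrier (ideals_set R)" using assms by (simp add: ideals_set_def)
  from S.nat_pow_mult[OF this, of m n] show ?thesis by (simp add: ideals_set_def)
qed

lemma ideal_pow_pow:
  assumes "ideal J R"
  shows "ideal_pow R (ideal_pow R J m) n = ideal_pow R J (m * n)"
proof -
  interpret S: comm_monoid "ideals_set R" by (rule ideals_set_is_comm_monoid)
  have "J \<in> carrier (ideals_set R)" using assms by (simp add: ideals_set_def)
  from S.nat_pow_pow[OF this, of m n] show ?thesis .
qed

lemma ideal_pow_Suc2: "ideal J R \<Longrightarrow> ideal_pow R J (Suc n) = J \<cdot> ideal_pow R J n"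
  by (metis ideal_pow_Suc ideal_pow_ideal ideal_prod_commute)

lemma ideal_pow_antimono:
  assumes "ideal J R" "m \<le> n"
  shows "ideal_pow R J n \<subseteq> ideal_pow R J m"
proof -
  have "ideal_pow R J n = ideal_pow R J m \<cdot> ideal_pow R J (n - m)"
    using ideal_pow_add[OF assms(1), of m "n - m"] assms(2) by simp
  then show ?thesis using ideal_prod_inter assms(1) by (metis Int_subset_iff ideal_pow_ideal)
qed

lemma ideal_pow_antimonoD: "a \<in> ideal_pow R J n \<Longrightarrow> ideal J R \<Longrightarrow> m \<le> n \<Longrightarrow> a \<in> ideal_pow R J m"
  using ideal_pow_antimono by blast

lemma ideal_pow_carrier: "ideal J R \<Longrightarrow> a \<in> ideal_pow R J n \<Longrightarrow> a \<in> carrier R"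
  using ideal.Icarr ideal_pow_ideal by metis

lemma ideal_pow_mult:
  assumes "ideal J R" "a \<in> ideal_pow R J m" "b \<in> ideal_pow R J n"
  shows "a \<otimes> b \<in> ideal_pow R J (m + n)"
  by (simp add: assms ideal_pow_add ideal_prod.prod)

lemma ideal_pow_elem_pow:
  assumes "ideal J R" "a \<in> ideal_pow R J m"
  shows "a [^] n \<in> ideal_pow R J (m * n)"
proof (induct n)
  case (Suc n)
  then show ?case using ideal_pow_mult[OF assms(1) Suc assms(2)] by (simp add: add.commute)
qed (simp add: assms)

lemma ideal_pow_base_mono: "J \<subseteq> K \<Longrightarrow> ideal_pow R J n \<subseteq> ideal_pow R K n"
  by (induct n) (simp_all only: ideal_pow_0 ideal_pow_Suc ideal_prod_mono order_refl)

end

section \<open>The Rees algebra is graded Noetherian\<close>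

context cring
begin

text \<open>The homogeneous ideal with components \<open>M n\<close> in the Rees algebra, whose
  component of degree n is K^n. Stability under \<open>K\<close> suffices because the Rees algebra
  is generated in degrees 0 and 1.\<close>

definition graded_family :: "'a set \<Rightarrow> (nat \<Rightarrow> 'a set) \<Rightarrow> bool"
  where "graded_family K M \<longleftrightarrow>
    (\<forall>n. ideal (M n) R \<and> M n \<subseteq> ideal_pow R K n \<and> K \<cdot> M n \<subseteq> M (Suc n))"

text \<open>
  The sums \<open>\<Sum>\<^bsub>i'<i\<^esub> u\<^bsup>i'\<^esup> K\<^bsup>i+j-i'\<^esup>\<close>, in total degree \<open>i + j\<close>; indexing by \<open>j\<close> instead of the degree
  avoids truncated subtraction.
\<close>

primrec lower_forms :: "'a \<Rightarrow> 'a set \<Rightarrow> nat \<Rightarrow> nat \<Rightarrow> 'a set"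
  where "lower_forms u K 0 j = {\<zero>}"
  | "lower_forms u K (Suc i) j =
      {t \<oplus> u [^] i \<otimes> g |t g. t \<in> lower_forms u K i (Suc j) \<and> g \<in> ideal_pow R K (Suc j)}"

text \<open>The leading coefficients of Hilbert's basis theorem, with \<open>u\<close> as the
  variable. Expansions in powers of \<open>u\<close> are not unique, so \<open>g\<close> counts as
  soon as one expansion of one element of \<open>M (i + j)\<close> ends in it.\<close>

definition leading_ideal :: "'a \<Rightarrow> 'a set \<Rightarrow> (nat \<Rightarrow> 'a set) \<Rightarrow> nat \<Rightarrow> nat \<Rightarrow> 'a set"
  where "leading_ideal u K M i j =
    {g \<in> ideal_pow R K j. \<exists>t \<in> lower_forms u K i j. t \<oplus> u [^] i \<otimes> g \<in> M (i + j)}"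

context
  fixes u K
  assumes u [simp]: "u \<in> carrier R" and K: "ideal K R"
begin

lemma lower_forms_ideal: "ideal (lower_forms u K i j) R"
proof (induct i arbitrary: j)
  case 0
  then show ?case by (simp add: zeroideal)
next
  case (Suc i)
  let ?T = "lower_forms u K i (Suc j)" and ?P = "ideal_pow R K (Suc j)"
  have T: "ideal ?T R" by (rule Suc)
  have P: "ideal ?P R" using K by blast
  note [simp] = ideal.Icarr[OF T] ideal.Icarr[OF P]
  show ?case
  proof (rule idealI_cring)
    show "lower_forms u K (Suc i) j \<subseteq> carrier R" by auto
    have "\<zero> \<oplus> u [^] i \<otimes> \<zero> \<in> lower_forms u K (Suc i) j"
      using ideal_zero[OF T] ideal_zero[OF P] unfolding lower_forms.simps by blast
    then show "\<zero> \<in> lower_forms u K (Suc i) j" by simp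
  next
    fix a b assume "a \<in> lower_forms u K (Suc i) j" "b \<in> lower_forms u K (Suc i) j"
    then obtain s g t h where *: "s \<in> ?T" "g \<in> ?P" "t \<in> ?T" "h \<in> ?P"
      "a = s \<oplus> u [^] i \<otimes> g" "b = t \<oplus> u [^] i \<otimes> h" by auto
    then have "a \<oplus> b = (s \<oplus> t) \<oplus> u [^] i \<otimes> (g \<oplus> h)" by (simp add: r_distr a_ac)
    moreover have "s \<oplus> t \<in> ?T" "g \<oplus> h \<in> ?P" using * ideal_add T P by auto
    ultimately show "a \<oplus> b \<in> lower_forms u K (Suc i) j" by auto
  next
    fix a r assume "a \<in> lower_forms u K (Suc i) j" and r: "r \<in> carrier R"
    then obtain s g where *: "s \<in> ?T" "g \<in> ?P" "a = s \<oplus> u [^] i \<otimes> g" by auto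
    then have "r \<otimes> a = (r \<otimes> s) \<oplus> u [^] i \<otimes> (r \<otimes> g)" using r by (simp add: r_distr m_lcomm)
    moreover have "r \<otimes> s \<in> ?T" "r \<otimes> g \<in> ?P" using * ideal_lmult T P r by auto
    ultimately show "r \<otimes> a \<in> lower_forms u K (Suc i) j" by auto
  qed
qed

lemma lower_forms_mult_K:
  assumes "k \<in> K" "t \<in> lower_forms u K i j"
  shows "k \<otimes> t \<in> lower_forms u K i (Suc j)"
  using assms(2)
proof (induct i arbitrary: t j)
  case 0
  then show ?case using assms(1) ideal.Icarr[OF K] by simp
next
  case (Suc i)
  then obtain s g where *: "s \<in> lower_forms u K i (Suc j)" "g \<in> ideal_pow R K (Suc j)"
    "t = s \<oplus> u [^] i \<otimes> g" by auto
  have [simp]: "k \<in> carrier R" "s \<in> carrier R" "g \<in> carrier R"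
    using assms(1) * ideal.Icarr[OF K] ideal.Icarr[OF lower_forms_ideal] ideal_pow_carrier[OF K] by blast+
  have "k \<otimes> t = (k \<otimes> s) \<oplus> u [^] i \<otimes> (k \<otimes> g)" using *(3) by (simp add: r_distr m_lcomm)
  moreover have "k \<otimes> g \<in> ideal_pow R K (Suc (Suc j))"
    using assms(1) *(2) by (simp only: ideal_pow_Suc2[OF K, of "Suc j"] ideal_prod.prod)
  ultimately show ?case using Suc(1)[OF *(1)] by auto
qed

lemma lower_forms_mult_u:
  assumes "t \<in> lower_forms u K i j"
  shows "u \<otimes> t \<in> lower_forms u K (Suc i) j"
  using assms
proof (induct i arbitrary: t j)
  case 0
  then have "u \<otimes> t = \<zero>" by simp
  then show ?case using lower_forms_ideal ideal_zero by metis
next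
  case (Suc i)
  then obtain s g where *: "s \<in> lower_forms u K i (Suc j)" "g \<in> ideal_pow R K (Suc j)"
    "t = s \<oplus> u [^] i \<otimes> g" by auto
  have [simp]: "s \<in> carrier R" "g \<in> carrier R"
    using * ideal.Icarr[OF lower_forms_ideal] ideal_pow_carrier[OF K] by blast+
  have "u \<otimes> t = (u \<otimes> s) \<oplus> u [^] Suc i \<otimes> g" using *(3) by (simp add: r_distr m_ac)
  then show ?case using Suc(1)[OF *(1)] *(2) lower_forms.simps(2)[of u K "Suc i" j] by blast
qed

text \<open>Multiply an expansion by u r + k: only the product of the top term with u r reaches the
  next power of \<open>u\<close>, and everything else stays among the lower terms. The top
  coefficient has degree 0 over \<open>K\<close>, so it is an arbitrary ring element.\<close>

lemma ideal_pow_insert_expand: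
  assumes "f \<in> ideal_pow R (PIdl u <+> K) n"
  shows "\<exists>t\<in>lower_forms u K n 0. \<exists>g\<in>carrier R. f = t \<oplus> u [^] n \<otimes> g"
proof -
  define full where "full n = {t \<oplus> u [^] n \<otimes> g |t g. t \<in> lower_forms u K n 0 \<and> g \<in> carrier R}" for n
  have fullI: "t \<in> lower_forms u K n 0 \<Longrightarrow> g \<in> carrier R \<Longrightarrow> t \<oplus> u [^] n \<otimes> g \<in> full n" for t g n
    unfolding full_def by blast
  have T: "ideal (lower_forms u K n 0) R" for n by (rule lower_forms_ideal)
  note [simp] = ideal.Icarr[OF T]
  \<comment> \<open>Once this is an ideal, the inclusion of an ideal product in it can be tested on
    products of two elements.\<close>
  have full_ideal: "ideal (full n) R" for n
  proof (rule idealI_cring)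
    show "full n \<subseteq> carrier R" by (auto simp: full_def)
    have "\<zero> \<oplus> u [^] n \<otimes> \<zero> \<in> full n" using fullI[OF ideal_zero[OF T]] by blast
    then show "\<zero> \<in> full n" by simp
  next
    fix a b assume "a \<in> full n" "b \<in> full n"
    then obtain s g t h where *: "s \<in> lower_forms u K n 0" "g \<in> carrier R"
      "t \<in> lower_forms u K n 0" "h \<in> carrier R"
      "a = s \<oplus> u [^] n \<otimes> g" "b = t \<oplus> u [^] n \<otimes> h" by (auto simp: full_def)
    then have "a \<oplus> b = (s \<oplus> t) \<oplus> u [^] n \<otimes> (g \<oplus> h)" by (simp add: r_distr a_ac)
    moreover have "s \<oplus> t \<in> lower_forms u K n 0" using * ideal_add T by auto
    ultimately show "a \<oplus> b \<in> full n" using * fullI by simp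
  next
    fix a r assume "a \<in> full n" and r: "r \<in> carrier R"
    then obtain s g where *: "s \<in> lower_forms u K n 0" "g \<in> carrier R" "a = s \<oplus> u [^] n \<otimes> g"
      by (auto simp: full_def)
    then have "r \<otimes> a = (r \<otimes> s) \<oplus> u [^] n \<otimes> (r \<otimes> g)" using r by (simp add: r_distr m_lcomm)
    moreover have "r \<otimes> s \<in> lower_forms u K n 0" using * ideal_lmult T r by auto
    ultimately show "r \<otimes> a \<in> full n" using * r fullI by simp
  qed
  have K_carrier: "k \<in> K \<Longrightarrow> k \<in> carrier R" for k using ideal.Icarr[OF K] .
  have "ideal_pow R (PIdl u <+> K) n \<subseteq> full n" for n
  proof (induct n)
    case 0
    have "a \<in> full 0" if "a \<in> carrier R" for a
      using fullI[of \<zero> 0 a] that by simp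
    then show ?case by auto
  next
    case (Suc n)
    have "f \<otimes> (u \<otimes> r \<oplus> k) \<in> full (Suc n)" if f: "f \<in> full n" and r: "r \<in> carrier R" and k: "k \<in> K" for f r k
    proof -
      from f obtain s g where *: "s \<in> lower_forms u K n 0" "g \<in> carrier R" "f = s \<oplus> u [^] n \<otimes> g"
        by (auto simp: full_def)
      note [simp] = *(2) r K_carrier[OF k]
      have [simp]: "s \<in> carrier R" using * by simp
      have "k \<otimes> g \<in> ideal_pow R K (Suc 0)" using k K ideal_rmult by (simp only: ideal_pow_1 *)
      with lower_forms_mult_K[OF k *(1)] have "k \<otimes> s \<oplus> u [^] n \<otimes> (k \<otimes> g) \<in> lower_forms u K (Suc n) 0"
        unfolding lower_forms.simps by blast
      moreover have "r \<otimes> (u \<otimes> s) \<in> lower_forms u K (Suc n) 0"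
        using lower_forms_mult_u[OF *(1)] T ideal_lmult r by blast
      ultimately have "(k \<otimes> s \<oplus> u [^] n \<otimes> (k \<otimes> g)) \<oplus> r \<otimes> (u \<otimes> s) \<in> lower_forms u K (Suc n) 0"
        using ideal_add[OF T] by blast
      moreover have "f \<otimes> (u \<otimes> r \<oplus> k) =
          ((k \<otimes> s \<oplus> u [^] n \<otimes> (k \<otimes> g)) \<oplus> r \<otimes> (u \<otimes> s)) \<oplus> u [^] Suc n \<otimes> (r \<otimes> g)"
        unfolding *(3) by (simp add: r_distr l_distr a_ac m_ac)
      moreover have "r \<otimes> g \<in> carrier R" by simp
      ultimately show ?thesis using fullI by (simp only:)
    qed
    note step = this
    have "\<forall>f\<in>full n. \<forall>v\<in>PIdl u <+> K. f \<otimes> v \<in> full (Suc n)"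
    proof (intro ballI)
      fix f v assume f: "f \<in> full n" and "v \<in> PIdl u <+> K"
      then obtain a k where "a \<in> PIdl u" "k \<in> K" "v = a \<oplus> k" unfolding mem_set_add_iff by blast
      then show "f \<otimes> v \<in> full (Suc n)" using step[OF f] unfolding mem_cgenideal_iff[OF u] by blast
    qed
    then have "full n \<cdot> (PIdl u <+> K) \<subseteq> full (Suc n)"
      using ideal_prod_subset_iff[OF full_ideal] by blast
    then show ?case unfolding ideal_pow_Suc
      using ideal_prod_mono[OF Suc order_refl] by blast
  qed
  then show ?thesis using assms unfolding full_def by blast
qed

end

section \<open>Leading ideals of a graded family\<close>

context
  fixes u K M
  assumes u [simp]: "u \<in> carrier R" and K: "ideal K R"
    and M: "graded_family (PIdl u <+> K) M"
begin

lemma family_ideal: "ideal (M n) R"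
  and family_prod: "(PIdl u <+> K) \<cdot> M n \<subseteq> M (Suc n)"
  using M by (auto simp only: graded_family_def)

lemma family_mult_u: "f \<in> M n \<Longrightarrow> u \<otimes> f \<in> M (Suc n)"
  and family_mult_K: "k \<in> K \<Longrightarrow> f \<in> M n \<Longrightarrow> k \<otimes> f \<in> M (Suc n)"
proof -
  have "u \<in> PIdl u" by (simp add: cgenideal_self)
  then have "u \<in> PIdl u <+> K" "K \<subseteq> PIdl u <+> K"
    using set_add_upper[OF cgenideal_ideal[OF u] K] by auto
  then show "f \<in> M n \<Longrightarrow> u \<otimes> f \<in> M (Suc n)" "k \<in> K \<Longrightarrow> f \<in> M n \<Longrightarrow> k \<otimes> f \<in> M (Suc n)"
    using family_prod ideal_prod.prod by (metis subsetD)+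
qed

lemma leading_ideal_ideal: "ideal (leading_ideal u K M i j) R"
proof (rule idealI_cring)
  let ?T = "lower_forms u K i j" and ?L = "leading_ideal u K M i j"
  have T: "ideal ?T R" by (rule lower_forms_ideal[OF u K])
  have P: "ideal (ideal_pow R K j) R" using K by blast
  note [simp] = ideal.Icarr[OF T] ideal.Icarr[OF P]
  show "?L \<subseteq> carrier R" by (auto simp: leading_ideal_def)
  have "\<zero> \<oplus> u [^] i \<otimes> \<zero> \<in> M (i + j)" using ideal_zero[OF family_ideal] by simp
  then show "\<zero> \<in> ?L" unfolding leading_ideal_def using ideal_zero[OF T] ideal_zero[OF P] by blast
  show "a \<oplus> b \<in> ?L" if "a \<in> ?L" "b \<in> ?L" for a b
  proof -
    from that obtain s t where *: "a \<in> ideal_pow R K j" "b \<in> ideal_pow R K j" "s \<in> ?T" "t \<in> ?T"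
      "s \<oplus> u [^] i \<otimes> a \<in> M (i + j)" "t \<oplus> u [^] i \<otimes> b \<in> M (i + j)"
      by (auto simp: leading_ideal_def)
    have "(s \<oplus> t) \<oplus> u [^] i \<otimes> (a \<oplus> b) = (s \<oplus> u [^] i \<otimes> a) \<oplus> (t \<oplus> u [^] i \<otimes> b)"
      using * by (simp add: r_distr a_ac)
    then have "(s \<oplus> t) \<oplus> u [^] i \<otimes> (a \<oplus> b) \<in> M (i + j)"
      using ideal_add[OF family_ideal *(5,6)] by simp
    then show ?thesis using ideal_add[OF T *(3,4)] ideal_add[OF P *(1,2)]
      unfolding leading_ideal_def by blast
  qed
  show "r \<otimes> a \<in> ?L" if "a \<in> ?L" "r \<in> carrier R" for a r
  proof -
    from that obtain s where *: "a \<in> ideal_pow R K j" "s \<in> ?T" "s \<oplus> u [^] i \<otimes> a \<in> M (i + j)"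
      by (auto simp: leading_ideal_def)
    have "(r \<otimes> s) \<oplus> u [^] i \<otimes> (r \<otimes> a) = r \<otimes> (s \<oplus> u [^] i \<otimes> a)"
      using * that by (simp add: r_distr m_lcomm)
    then have "(r \<otimes> s) \<oplus> u [^] i \<otimes> (r \<otimes> a) \<in> M (i + j)"
      using ideal_lmult[OF family_ideal *(3)] that by simp
    then show ?thesis using ideal_lmult[OF T *(2)] ideal_lmult[OF P *(1)] that
      unfolding leading_ideal_def by blast
  qed
qed

lemma leading_ideal_graded_family: "graded_family K (leading_ideal u K M i)"
proof -
  have "k \<otimes> g \<in> leading_ideal u K M i (Suc j)"
    if k: "k \<in> K" and g: "g \<in> leading_ideal u K M i j" for k g j
  proof -
    from g obtain s where *: "g \<in> ideal_pow R K j" "s \<in> lower_forms u K i j"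
      "s \<oplus> u [^] i \<otimes> g \<in> M (i + j)" by (auto simp: leading_ideal_def)
    have [simp]: "k \<in> carrier R" "g \<in> carrier R" "s \<in> carrier R"
      using k * ideal.Icarr[OF K] ideal_pow_carrier[OF K] ideal.Icarr[OF lower_forms_ideal[OF u K]]
      by blast+
    have "k \<otimes> s \<oplus> u [^] i \<otimes> (k \<otimes> g) = k \<otimes> (s \<oplus> u [^] i \<otimes> g)"
      by (simp add: r_distr m_lcomm)
    then have "k \<otimes> s \<oplus> u [^] i \<otimes> (k \<otimes> g) \<in> M (i + Suc j)"
      using family_mult_K[OF k *(3)] by simp
    moreover have "k \<otimes> g \<in> ideal_pow R K (Suc j)"
      unfolding ideal_pow_Suc2[OF K] using k *(1) by (rule ideal_prod.prod)
    ultimately show ?thesis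
      using lower_forms_mult_K[OF u K k *(2)] unfolding leading_ideal_def by blast
  qed
  then show ?thesis
    unfolding graded_family_def ideal_prod_subset_iff[OF leading_ideal_ideal]
    using leading_ideal_ideal by (auto simp: leading_ideal_def)
qed

text \<open>Multiplication by \<open>u\<close> moves every term up by one power and leaves the top
  coefficient unchanged.\<close>

lemma leading_ideal_mono_Suc: "leading_ideal u K M i j \<subseteq> leading_ideal u K M (Suc i) j"
proof
  fix g assume "g \<in> leading_ideal u K M i j"
  then obtain s where *: "g \<in> ideal_pow R K j" "s \<in> lower_forms u K i j"
    "s \<oplus> u [^] i \<otimes> g \<in> M (i + j)" by (auto simp: leading_ideal_def)
  have [simp]: "g \<in> carrier R" "s \<in> carrier R"
    using * ideal_pow_carrier[OF K] ideal.Icarr[OF lower_forms_ideal[OF u K]] by blast+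
  have "u \<otimes> s \<oplus> u [^] Suc i \<otimes> g = u \<otimes> (s \<oplus> u [^] i \<otimes> g)"
    by (simp add: r_distr m_ac)
  then have "u \<otimes> s \<oplus> u [^] Suc i \<otimes> g \<in> M (Suc i + j)" using family_mult_u[OF *(3)] by simp
  then show "g \<in> leading_ideal u K M (Suc i) j"
    using lower_forms_mult_u[OF u K *(2)] *(1) unfolding leading_ideal_def by blast
qed

text \<open>Supplies the elements subtracted in the descent: a leading coefficient generated from
  one degree lower belongs to an element that is itself generated from one degree lower. Each
  product is lifted by lifting its second factor to \<open>M\<close>.\<close>

lemma leading_ideal_prod_lift:
  assumes "g \<in> K \<cdot> leading_ideal u K M i j"
  shows "\<exists>t\<in>lower_forms u K i (Suc j). t \<oplus> u [^] i \<otimes> g \<in> (PIdl u <+> K) \<cdot> M (i + j)"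
  using assms
proof (induct g rule: ideal_prod.induct)
  case (prod k g)
  then obtain s where *: "g \<in> ideal_pow R K j" "s \<in> lower_forms u K i j"
    "s \<oplus> u [^] i \<otimes> g \<in> M (i + j)" by (auto simp: leading_ideal_def)
  have [simp]: "k \<in> carrier R" "g \<in> carrier R" "s \<in> carrier R"
    using prod * ideal.Icarr[OF K] ideal_pow_carrier[OF K] ideal.Icarr[OF lower_forms_ideal[OF u K]]
    by blast+
  have "k \<otimes> s \<oplus> u [^] i \<otimes> (k \<otimes> g) = k \<otimes> (s \<oplus> u [^] i \<otimes> g)"
    by (simp add: r_distr m_lcomm)
  moreover have "k \<in> PIdl u <+> K"
    using prod(1) set_add_upper[OF cgenideal_ideal[OF u] K] by blast
  ultimately have "k \<otimes> s \<oplus> u [^] i \<otimes> (k \<otimes> g) \<in> (PIdl u <+> K) \<cdot> M (i + j)"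
    using *(3) by (simp add: ideal_prod.prod)
  then show ?case using lower_forms_mult_K[OF u K prod(1) *(2)] by blast
next
  case (sum g h)
  then obtain s t where *: "s \<in> lower_forms u K i (Suc j)" "t \<in> lower_forms u K i (Suc j)"
    "s \<oplus> u [^] i \<otimes> g \<in> (PIdl u <+> K) \<cdot> M (i + j)"
    "t \<oplus> u [^] i \<otimes> h \<in> (PIdl u <+> K) \<cdot> M (i + j)" by blast
  have [simp]: "s \<in> carrier R" "t \<in> carrier R" "g \<in> carrier R" "h \<in> carrier R"
    using * sum(1,3) ideal.Icarr[OF lower_forms_ideal[OF u K]]
      ideal_prod_in_carrier[OF K leading_ideal_ideal] by blast+
  have "(s \<oplus> t) \<oplus> u [^] i \<otimes> (g \<oplus> h) = (s \<oplus> u [^] i \<otimes> g) \<oplus> (t \<oplus> u [^] i \<otimes> h)"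
    by (simp add: r_distr a_ac)
  then have "(s \<oplus> t) \<oplus> u [^] i \<otimes> (g \<oplus> h) \<in> (PIdl u <+> K) \<cdot> M (i + j)"
    using ideal_prod.sum[OF *(3,4)] by simp
  then show ?case using ideal_add[OF lower_forms_ideal[OF u K] *(1,2)] by blast
qed

text \<open>As in Hilbert's basis theorem: subtract an element of (u, K) M_n with the same top term
  and continue with the difference, whose expansion stops one power of \<open>u\<close>
  earlier.\<close>

lemma leading_ideal_descent:
  assumes stable: "\<And>i j. i0 \<le> i \<Longrightarrow> leading_ideal u K M (Suc i) j \<subseteq> leading_ideal u K M i j"
    and gen: "\<And>i j. i \<le> i0 \<Longrightarrow> n0 \<le> i + j \<Longrightarrow>
      leading_ideal u K M i (Suc j) \<subseteq> K \<cdot> leading_ideal u K M i j"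
    and "n0 \<le> n" "i + j = Suc n" "i0 \<le> n"
    and "t \<in> lower_forms u K i j" "g \<in> ideal_pow R K j" "t \<oplus> u [^] i \<otimes> g \<in> M (Suc n)"
  shows "t \<oplus> u [^] i \<otimes> g \<in> (PIdl u <+> K) \<cdot> M n"
  using assms(4,6-)
proof (induct i arbitrary: j t g)
  let ?K = "PIdl u <+> K"
  have K': "ideal ?K R" using add_ideals[OF cgenideal_ideal[OF u] K] .
  have KM: "ideal (?K \<cdot> M n) R" by (rule ideal_prod_is_ideal[OF K' family_ideal])
  have KM_sub: "?K \<cdot> M n \<subseteq> M (Suc n)" by (rule family_prod)
  have u_mem: "u \<in> ?K" using set_add_upper[OF cgenideal_ideal[OF u] K] cgenideal_self[OF u] by blast
  {
    case 0
    \<comment> \<open>No lower terms are left, so the element is its own leading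
      coefficient.\<close>
    have g: "g \<in> K \<cdot> leading_ideal u K M 0 n"
      using gen[of 0 n] 0 assms(3) unfolding leading_ideal_def by auto
    obtain s where s: "s \<in> lower_forms u K 0 (Suc n)" "s \<oplus> u [^] (0::nat) \<otimes> g \<in> ?K \<cdot> M n"
      using leading_ideal_prod_lift[OF g] by auto
    then show ?case using 0 by auto
  next
    case (Suc i)
    have g: "g \<in> leading_ideal u K M (Suc i) j"
      using Suc(2-) unfolding leading_ideal_def by auto
    \<comment> \<open>From \<open>i0\<close> on, stability provides an element of \<open>M n\<close>
      with top coefficient \<open>g\<close>, and multiplying it by \<open>u\<close> is enough. Below
      \<open>i0\<close>, \<open>g\<close> is generated by \<open>K\<close> from one degree lower and
      can be lifted.\<close>
    have "\<exists>s\<in>lower_forms u K (Suc i) j. s \<oplus> u [^] Suc i \<otimes> g \<in> ?K \<cdot> M n"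
    proof (cases "i0 \<le> i")
      case True
      then have "g \<in> leading_ideal u K M i j" using stable g by blast
      then obtain s where s: "s \<in> lower_forms u K i j" "s \<oplus> u [^] i \<otimes> g \<in> M n"
        using Suc(2) by (auto simp: leading_ideal_def)
      have [simp]: "g \<in> carrier R" "s \<in> carrier R"
        using s Suc(4) ideal_pow_carrier[OF K] ideal.Icarr[OF lower_forms_ideal[OF u K]] by blast+
      have "u \<otimes> s \<oplus> u [^] Suc i \<otimes> g = u \<otimes> (s \<oplus> u [^] i \<otimes> g)" by (simp add: r_distr m_ac)
      then have "u \<otimes> s \<oplus> u [^] Suc i \<otimes> g \<in> ?K \<cdot> M n" using s(2) u_mem by (simp add: ideal_prod.prod)
      then show ?thesis using lower_forms_mult_u[OF u K s(1)] by blast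
    next
      case False
      \<comment> \<open>\<open>j\<close> is positive because i < i0 \<le> n.\<close>
      then obtain j' where j': "j = Suc j'" using Suc(2) assms(5) by (cases j) auto
      then have n: "n = Suc i + j'" using Suc(2) by simp
      then have "g \<in> K \<cdot> leading_ideal u K M (Suc i) j'"
        using gen[of "Suc i" j'] g False assms(3) j' by auto
      from leading_ideal_prod_lift[OF this] show ?thesis using n j' by simp
    qed
    then obtain s where s: "s \<in> lower_forms u K (Suc i) j" "s \<oplus> u [^] Suc i \<otimes> g \<in> ?K \<cdot> M n" by blast
    let ?f = "t \<oplus> u [^] Suc i \<otimes> g" and ?h = "s \<oplus> u [^] Suc i \<otimes> g"
    have [simp]: "g \<in> carrier R" "s \<in> carrier R" "t \<in> carrier R"
      using s Suc(3,4) ideal_pow_carrier[OF K] ideal.Icarr[OF lower_forms_ideal[OF u K]] by blast+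
    have "t \<ominus> s \<in> lower_forms u K (Suc i) j"
      using ideal_minus[OF lower_forms_ideal[OF u K]] s(1) Suc(3) by blast
    then obtain t' g' where t': "t' \<in> lower_forms u K i (Suc j)" "g' \<in> ideal_pow R K (Suc j)"
      "t \<ominus> s = t' \<oplus> u [^] i \<otimes> g'" by auto
    define w where "w = u [^] Suc i \<otimes> g"
    have [simp]: "w \<in> carrier R" by (simp add: w_def)
    have eq: "(t \<oplus> w) \<ominus> (s \<oplus> w) = t \<ominus> s"
      using \<open>t \<in> carrier R\<close> \<open>s \<in> carrier R\<close> \<open>w \<in> carrier R\<close> by algebra
    have "?f \<ominus> ?h \<in> M (Suc n)" using ideal_minus[OF family_ideal] Suc(5) s(2) KM_sub by blast
    then have "t' \<oplus> u [^] i \<otimes> g' \<in> M (Suc n)" using eq t'(3) unfolding w_def by simp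
    then have "t' \<oplus> u [^] i \<otimes> g' \<in> ?K \<cdot> M n"
      using Suc(1)[of "Suc j" t' g'] t' Suc(2) by simp
    then have "?f \<ominus> ?h \<in> ?K \<cdot> M n" using eq t'(3) unfolding w_def by simp
    then show ?case using ideal_diff_cancel[OF KM _ s(2)] by simp
  }
qed

end

end

section \<open>Chain conditions and generation of graded families\<close>

locale noetherian_cring = cring R + noetherian_ring R for R (structure)
begin

lemma ideal_chain_stable:
  fixes F :: "nat \<Rightarrow> 'a set"
  assumes "\<And>i. ideal (F i) R" "\<And>i. F i \<subseteq> F (Suc i)"
  shows "\<exists>i0. \<forall>i\<ge>i0. F i = F i0"
proof -
  have mono: "i \<le> j \<Longrightarrow> F i \<subseteq> F j" for i j using assms(2) by (rule lift_Suc_mono_le)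
  have "subset.chain {I. ideal I R} (range F)"
    unfolding subset_chain_def using assms(1) mono by (auto 0 0) (metis nat_le_linear subsetD)
  then have "\<Union>(range F) \<in> range F" by (intro ideal_chain_is_trivial) auto
  then obtain i0 where "\<Union>(range F) = F i0" by auto
  then have "F i = F i0" if "i \<ge> i0" for i using mono[OF that] by blast
  then show ?thesis by blast
qed

lemma maximal_ideal_in_family:
  assumes "C \<noteq> {}" "\<And>J. J \<in> C \<Longrightarrow> ideal J R"
  shows "\<exists>J\<in>C. \<forall>L\<in>C. J \<subseteq> L \<longrightarrow> L = J"
proof (rule subset_Zorn_nonempty[OF assms(1)])
  fix D assume D: "D \<noteq> {}" "subset.chain C D"
  then have "subset.chain {I. ideal I R} D" using assms(2) by (auto simp: subset_chain_def)
  then have "\<Union>D \<in> D" using ideal_chain_is_trivial D(1) by blast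
  then show "\<Union>D \<in> C" using D(2) by (auto simp: subset_chain_def)
qed

text \<open>
  Induction on the number of generators of \<open>K\<close>: the leading coefficients with respect to the
  powers of one generator \<open>u\<close> form an ascending chain of graded families over the remaining generators.
\<close>

lemma graded_family_generated_finite:
  assumes "finite S" "S \<subseteq> carrier R" "graded_family (Idl S) M"
  shows "\<exists>n0. \<forall>n\<ge>n0. M (Suc n) \<subseteq> (Idl S) \<cdot> M n"
  using assms
proof (induct S arbitrary: M rule: finite_induct)
  case empty
  have "{} \<subseteq> {\<zero>}" by simp
  then have "Idl {} = {\<zero>}" using genideal_minimal[OF zeroideal] genideal_ideal[of "{}"] ideal_zero by fastforce
  then have M: "M (Suc n) \<subseteq> {\<zero>}" "ideal (M n) R" for n
    using empty(2) ideal_prod_zero[of "ideal_pow R {\<zero>} n"] zeroideal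
    unfolding graded_family_def ideal_pow_Suc by (metis ideal_pow_Suc ideal_pow_ideal)+
  have "ideal ((Idl {}) \<cdot> M n) R" for n using ideal_prod_is_ideal[OF genideal_ideal M(2)] by simp
  then have "M (Suc n) \<subseteq> (Idl {}) \<cdot> M n" for n using M(1) ideal_zero by blast
  then show ?case by blast
next
  case (insert u S)
  let ?K = "Idl S"
  have u: "u \<in> carrier R" and S: "S \<subseteq> carrier R" using insert by auto
  have K: "ideal ?K R" using S by (rule genideal_ideal)
  have "Idl (insert u S) = Idl (PIdl u \<union> ?K)"
  proof
    have "insert u S \<subseteq> PIdl u \<union> ?K" using genideal_self[OF S] cgenideal_self[OF u] by auto
    then show "Idl (insert u S) \<subseteq> Idl (PIdl u \<union> ?K)"
      using subset_Idl_subset ideal_in_carrier[OF K] ideal_in_carrier[OF cgenideal_ideal[OF u]] by simp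
    have I: "ideal (Idl (insert u S)) R" using insert by (auto intro: genideal_ideal)
    moreover have sub: "insert u S \<subseteq> Idl (insert u S)" by (rule genideal_self) (use u S in simp)
    ultimately have "PIdl u \<union> ?K \<subseteq> Idl (insert u S)"
      using cgenideal_minimal genideal_minimal[OF I] by simp
    then show "Idl (PIdl u \<union> ?K) \<subseteq> Idl (insert u S)" using genideal_minimal[OF I] by blast
  qed
  then have eq: "Idl (insert u S) = PIdl u <+> ?K"
    using union_genideal[OF cgenideal_ideal[OF u] K] by simp
  have M: "graded_family (PIdl u <+> ?K) M" using insert(5) eq by simp
  define L where "L = leading_ideal u ?K M"
  have L_fam: "graded_family ?K (L i)" for i
    unfolding L_def by (rule leading_ideal_graded_family[OF u K M])
  have L_ideal: "ideal (L i j) R" for i j using L_fam by (simp add: graded_family_def)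
  have L_prod: "?K \<cdot> L i j \<subseteq> L i (Suc j)" for i j using L_fam by (simp add: graded_family_def)
  have L_mono: "i \<le> i' \<Longrightarrow> L i j \<subseteq> L i' j" for i i' j
    using leading_ideal_mono_Suc[OF u K M] unfolding L_def by (rule lift_Suc_mono_le)
  have L_gen: "\<exists>n0. \<forall>n\<ge>n0. L i (Suc n) \<subseteq> ?K \<cdot> L i n" for i
    using insert(3)[OF S L_fam] .
  have "\<exists>i0. \<forall>i\<ge>i0. L i j = L i0 j" for j
    using ideal_chain_stable[of "\<lambda>i. L i j"] L_ideal L_mono by simp
  then obtain s where s: "\<And>i j. i \<ge> s j \<Longrightarrow> L i j = L (s j) j" by metis
  \<comment> \<open>The limit of the leading ideals in each degree. The index \<open>s j\<close> at
    which it is reached may depend on \<open>j\<close>; applying the induction hypothesis to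
    \<open>N\<close> makes it uniform.\<close>
  define N where "N j = L (s j) j" for j
  have L_N: "L i j \<subseteq> N j" for i j
    unfolding N_def using s[of j "max i (s j)"] L_mono[of i "max i (s j)" j] by simp
  have "graded_family ?K N"
  proof -
    have "?K \<cdot> N j \<subseteq> N (Suc j)" for j unfolding N_def using L_prod L_N N_def by fastforce
    then show ?thesis using L_fam unfolding graded_family_def N_def by blast
  qed
  then obtain d where d: "\<And>n. n \<ge> d \<Longrightarrow> N (Suc n) \<subseteq> ?K \<cdot> N n" using insert(3)[OF S] by blast
  \<comment> \<open>Stabilisation in the finitely many degrees up to \<open>d\<close> suffices:
    beyond \<open>d\<close> the limit is generated by \<open>K\<close> from below.\<close>
  define i0 where "i0 = Max (s ` {..d})"
  have i0: "j \<le> d \<Longrightarrow> s j \<le> i0" for j by (simp add: i0_def)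
  have stable: "N j \<subseteq> L i j" if "i \<ge> i0" for i j
  proof (induct j)
    case 0
    then show ?case using s[of 0 i] i0[of 0] that by (simp add: N_def)
  next
    case (Suc j)
    show ?case
    proof (cases "Suc j \<le> d")
      case True
      then show ?thesis using s[of "Suc j" i] i0[of "Suc j"] that by (simp add: N_def)
    next
      case False
      then have "N (Suc j) \<subseteq> ?K \<cdot> N j" using d by simp
      also have "\<dots> \<subseteq> ?K \<cdot> L i j" using Suc ideal_prod_mono by blast
      also have "\<dots> \<subseteq> L i (Suc j)" by (rule L_prod)
      finally show ?thesis .
    qed
  qed
  from L_gen obtain e where e: "\<And>i n. n \<ge> e i \<Longrightarrow> L i (Suc n) \<subseteq> ?K \<cdot> L i n" by metis
  \<comment> \<open>If i \<le> i0 and i + j \<ge> n0, then \<open>j\<close> is past the generation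
    bound \<open>e i\<close>. Only the finitely many families with index up to \<open>i0\<close>
    matter.\<close>
  define n0 where "n0 = i0 + Max (e ` {..i0})"
  have e': "i \<le> i0 \<Longrightarrow> e i \<le> Max (e ` {..i0})" for i by simp
  have "M (Suc n) \<subseteq> (PIdl u <+> ?K) \<cdot> M n" if n: "n \<ge> n0" for n
  proof
    fix f assume f: "f \<in> M (Suc n)"
    then have "f \<in> ideal_pow R (PIdl u <+> ?K) (Suc n)" using M unfolding graded_family_def by blast
    then obtain t g where tg: "t \<in> lower_forms u ?K (Suc n) 0" "g \<in> carrier R" "f = t \<oplus> u [^] Suc n \<otimes> g"
      using ideal_pow_insert_expand[OF u K] by blast
    have "t \<oplus> u [^] Suc n \<otimes> g \<in> (PIdl u <+> ?K) \<cdot> M n"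
    proof (rule leading_ideal_descent[OF u K M, of i0 n0 n "Suc n" 0])
      show "leading_ideal u ?K M (Suc i) j \<subseteq> leading_ideal u ?K M i j" if "i0 \<le> i" for i j
        using stable[OF that] L_N unfolding L_def by blast
      show "leading_ideal u ?K M i (Suc j) \<subseteq> ?K \<cdot> leading_ideal u ?K M i j"
        if "i \<le> i0" "n0 \<le> i + j" for i j
      proof -
        have "e i \<le> j" using e'[OF that(1)] that unfolding n0_def by linarith
        then show ?thesis using e[of i j] unfolding L_def by simp
      qed
    qed (use n tg f in \<open>auto simp: n0_def\<close>)
    then show "f \<in> (PIdl u <+> ?K) \<cdot> M n" using tg by simp
  qed
  then show ?case unfolding eq by blast
qed

theorem graded_family_generated:
  assumes "ideal K R" "graded_family K M"
  shows "\<exists>n0. \<forall>n\<ge>n0. M (Suc n) \<subseteq> K \<cdot> M n"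
proof -
  obtain S where "S \<subseteq> carrier R" "finite S" "K = Idl S" using finetely_gen[OF assms(1)] by blast
  then show ?thesis using graded_family_generated_finite assms(2) by blast
qed

end

section \<open>Artin--Rees and integrality\<close>

context cring
begin

lemma mem_ideal_colon_iff: "a \<in> ideal_colon R J K \<longleftrightarrow> a \<in> carrier R \<and> (\<forall>k\<in>K. a \<otimes> k \<in> J)"
  by (simp add: ideal_colon_def)

lemma ideal_colon_ideal:
  assumes "ideal J R" "K \<subseteq> carrier R"
  shows "ideal (ideal_colon R J K) R"
proof (rule idealI_cring)
  show "ideal_colon R J K \<subseteq> carrier R" by (auto simp: ideal_colon_def)
  show "\<zero> \<in> ideal_colon R J K"
    using ideal_zero[OF assms(1)] assms(2) by (auto simp: mem_ideal_colon_iff subset_iff)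
  show "a \<oplus> b \<in> ideal_colon R J K" if "a \<in> ideal_colon R J K" "b \<in> ideal_colon R J K" for a b
    using that assms(2) ideal_add[OF assms(1)] by (auto simp: mem_ideal_colon_iff l_distr subset_iff)
  show "r \<otimes> a \<in> ideal_colon R J K" if "a \<in> ideal_colon R J K" "r \<in> carrier R" for a r
    using that assms(2) ideal_lmult[OF assms(1)] by (auto simp: mem_ideal_colon_iff m_assoc subset_iff)
qed

lemma ideal_prod_cgenideal:
  assumes "ideal J R" "x \<in> carrier R"
  shows "J \<cdot> (PIdl x) = {x \<otimes> a |a. a \<in> J}"
proof
  have J: "a \<in> J \<Longrightarrow> a \<in> carrier R" for a using ideal.Icarr[OF assms(1)] .
  show "{x \<otimes> a |a. a \<in> J} \<subseteq> J \<cdot> (PIdl x)"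
  proof
    fix s assume "s \<in> {x \<otimes> a |a. a \<in> J}"
    then obtain a where a: "s = x \<otimes> a" "a \<in> J" by blast
    then show "s \<in> J \<cdot> (PIdl x)"
      using ideal_prod.prod[OF a(2) cgenideal_self[OF assms(2)], of R] J assms(2) m_comm by metis
  qed
  show "J \<cdot> (PIdl x) \<subseteq> {x \<otimes> a |a. a \<in> J}"
  proof
    fix s assume "s \<in> J \<cdot> (PIdl x)"
    then show "s \<in> {x \<otimes> a |a. a \<in> J}"
    proof (induct s rule: ideal_prod.induct)
      case (prod a b)
      then obtain r where "r \<in> carrier R" "b = x \<otimes> r" using mem_cgenideal_iff[OF assms(2)] by blast
      then have "a \<otimes> b = x \<otimes> (a \<otimes> r)" "a \<otimes> r \<in> J"
        using prod(1) J[OF prod(1)] assms(2) ideal_rmult[OF assms(1)] by (auto simp: m_ac)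
      then show ?case by blast
    next
      case (sum s t)
      then obtain a b where ab: "s = x \<otimes> a" "t = x \<otimes> b" "a \<in> J" "b \<in> J" by blast
      have "s \<oplus> t = x \<otimes> (a \<oplus> b)" using ab J assms(2) by (simp add: r_distr)
      then show ?case using ideal_add[OF assms(1) ab(3,4)] by blast
    qed
  qed
qed

definition nonzerodivisor :: "'a \<Rightarrow> bool"
  where "nonzerodivisor x \<longleftrightarrow> x \<in> carrier R \<and> (\<forall>z\<in>carrier R. x \<otimes> z = \<zero> \<longrightarrow> z = \<zero>)"

lemma nonzerodivisor_cancel:
  assumes "nonzerodivisor x" "a \<in> carrier R" "b \<in> carrier R" "x \<otimes> a = x \<otimes> b"
  shows "a = b"
proof -
  have [simp]: "x \<in> carrier R" using assms(1) by (simp add: nonzerodivisor_def)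
  have "x \<otimes> (a \<ominus> b) = x \<otimes> a \<ominus> x \<otimes> b" using assms(2,3) \<open>x \<in> carrier R\<close> by algebra
  also have "\<dots> = \<zero>" using assms by (simp add: a_minus_def r_neg)
  finally have "a \<ominus> b = \<zero>" using assms(1-3) unfolding nonzerodivisor_def by simp
  then show ?thesis using assms(2,3) by simp
qed

end

context noetherian_cring
begin

text \<open>The traces of the powers of \<open>K\<close> on \<open>N\<close> form a graded family.
  Generation from degree \<open>k\<close> on, unwound n times, produces the factor K^n.\<close>

lemma artin_rees:
  assumes K: "ideal K R" and N: "ideal N R"
  shows "\<exists>k. \<forall>n. ideal_pow R K (n + k) \<inter> N \<subseteq> ideal_pow R K n \<cdot> N"
proof -
  define M where "M n = ideal_pow R K n \<inter> N" for n
  have M: "ideal (M n) R" for n unfolding M_def using K N by (blast intro: i_intersect)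
  have "K \<cdot> M n \<subseteq> M (Suc n)" for n
    unfolding ideal_prod_subset_iff[OF M]
    by (auto simp only: M_def ideal_pow_Suc2[OF K] Int_iff intro: ideal_prod.prod)
      (use ideal_lmult[OF N] ideal.Icarr[OF K] in blast)
  then have "graded_family K M" using M by (auto simp: graded_family_def M_def)
  then obtain k where k: "\<And>n. n \<ge> k \<Longrightarrow> M (Suc n) \<subseteq> K \<cdot> M n"
    using graded_family_generated[OF K] by blast
  have "M (n + k) \<subseteq> ideal_pow R K n \<cdot> M k" for n
  proof (induct n)
    case 0
    then show ?case using ideal_prod_one[OF M] ideal_prod_commute[OF M oneideal] by simp
  next
    case (Suc n)
    have "M (Suc n + k) \<subseteq> K \<cdot> M (n + k)" using k[of "n + k"] by simp
    also have "\<dots> \<subseteq> K \<cdot> (ideal_pow R K n \<cdot> M k)" using Suc ideal_prod_mono by blast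
    also have "\<dots> = ideal_pow R K (Suc n) \<cdot> M k"
      unfolding ideal_pow_Suc2[OF K] using ideal_prod_assoc[OF K _ M] K by simp
    finally show ?case .
  qed
  also have "ideal_pow R K n \<cdot> M k \<subseteq> ideal_pow R K n \<cdot> N" for n
    by (rule ideal_prod_mono) (auto simp: M_def)
  finally show ?thesis unfolding M_def by blast
qed

text \<open>Artin-Rees for the principal ideal of \<open>x\<close>: an element of K^n (x) is
  \<open>x\<close> times an element of K^n, and \<open>x\<close> cancels.\<close>

lemma artin_rees_nonzerodivisor:
  assumes K: "ideal K R" and x: "nonzerodivisor x"
  shows "\<exists>k. \<forall>n. \<forall>z\<in>carrier R. x \<otimes> z \<in> ideal_pow R K (n + k) \<longrightarrow> z \<in> ideal_pow R K n"
proof -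
  have xc: "x \<in> carrier R" using x by (simp add: nonzerodivisor_def)
  obtain k where k: "\<And>n. ideal_pow R K (n + k) \<inter> PIdl x \<subseteq> ideal_pow R K n \<cdot> (PIdl x)"
    using artin_rees[OF K cgenideal_ideal[OF xc]] by blast
  have "z \<in> ideal_pow R K n" if "z \<in> carrier R" "x \<otimes> z \<in> ideal_pow R K (n + k)" for n z
  proof -
    have "x \<otimes> z \<in> PIdl x" using that(1) mem_cgenideal_iff[OF xc] by blast
    then have "x \<otimes> z \<in> ideal_pow R K n \<cdot> (PIdl x)" using k that(2) by blast
    then obtain a where a: "x \<otimes> z = x \<otimes> a" "a \<in> ideal_pow R K n"
      using ideal_prod_cgenideal[OF ideal_pow_ideal[OF K] xc] by blast
    then show ?thesis using nonzerodivisor_cancel[OF x that(1) _ a(1)] ideal_pow_carrier[OF K a(2)] by simp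
  qed
  then show ?thesis by blast
qed

text \<open>The core of Krull's intersection theorem: Artin-Rees for the ideal (z) gives that
  \<open>z\<close> lies in K (z).\<close>

lemma mem_all_powers:
  assumes K: "ideal K R" and z: "z \<in> carrier R" "\<And>n. z \<in> ideal_pow R K n"
  shows "\<exists>a\<in>K. z = z \<otimes> a"
proof -
  obtain k where "ideal_pow R K (Suc 0 + k) \<inter> PIdl z \<subseteq> ideal_pow R K (Suc 0) \<cdot> (PIdl z)"
    using artin_rees[OF K cgenideal_ideal[OF z(1)]] by blast
  then have "z \<in> K \<cdot> (PIdl z)"
    unfolding ideal_pow_1[OF K] using z(2) cgenideal_self[OF z(1)] by blast
  then show ?thesis using ideal_prod_cgenideal[OF K z(1)] by blast
qed

text \<open>Unfolds to the sum of the ideals y z^j K^(n+d-j) over j \<le> n, of total degree n + d.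
  As with \<open>lower_forms\<close>, the index \<open>d\<close> replaces a truncated
  subtraction.\<close>

primrec denom_forms :: "'a \<Rightarrow> 'a \<Rightarrow> 'a set \<Rightarrow> nat \<Rightarrow> nat \<Rightarrow> 'a set"
  where "denom_forms y z K 0 d = ideal_pow R K d \<cdot> (PIdl y)"
  | "denom_forms y z K (Suc n) d =
      denom_forms y z K n (Suc d) <+> ideal_pow R K d \<cdot> (PIdl (y \<otimes> z [^] Suc n))"

context
  fixes y z K
  assumes y [simp]: "y \<in> carrier R" and z [simp]: "z \<in> carrier R" and K: "ideal K R"
begin

lemma denom_forms_ideal: "ideal (denom_forms y z K n d) R"
  by (induct n arbitrary: d)
    (simp_all only: denom_forms.simps add_ideals ideal_prod_is_ideal cgenideal_ideal ideal_pow_ideal K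
      m_closed y z nat_pow_closed)

lemma denom_forms_prod: "K \<cdot> denom_forms y z K n d \<subseteq> denom_forms y z K n (Suc d)"
proof (induct n arbitrary: d)
  case 0
  then show ?case
    by (simp only: denom_forms.simps ideal_pow_Suc2[OF K] order_refl
        ideal_prod_assoc[OF K ideal_pow_ideal[OF K] cgenideal_ideal[OF y]])
next
  case (Suc n)
  let ?P = "PIdl (y \<otimes> z [^] Suc n)"
  have P: "ideal ?P R" by (rule cgenideal_ideal) simp
  have "K \<cdot> denom_forms y z K (Suc n) d =
      (K \<cdot> denom_forms y z K n (Suc d)) <+> (K \<cdot> (ideal_pow R K d \<cdot> ?P))"
    unfolding denom_forms.simps
    by (rule ideal_prod_r_distr[OF K denom_forms_ideal ideal_prod_is_ideal[OF ideal_pow_ideal[OF K] P]])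
  also have "K \<cdot> (ideal_pow R K d \<cdot> ?P) = ideal_pow R K (Suc d) \<cdot> ?P"
    unfolding ideal_pow_Suc2[OF K] by (rule ideal_prod_assoc[OF K ideal_pow_ideal[OF K] P, symmetric])
  finally show ?case
    unfolding denom_forms.simps using set_add_mono[OF Suc order_refl] by simp
qed

lemma denom_forms_subset:
  assumes "\<And>n. y \<otimes> z [^] n \<in> ideal_pow R K n"
  shows "denom_forms y z K n d \<subseteq> ideal_pow R K (n + d)"
proof -
  have *: "ideal_pow R K d \<cdot> (PIdl (y \<otimes> z [^] n)) \<subseteq> ideal_pow R K (n + d)" for n d
  proof -
    have "PIdl (y \<otimes> z [^] n) \<subseteq> ideal_pow R K n"
      using assms cgenideal_subset_iff[OF ideal_pow_ideal[OF K]] by simp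
    then show ?thesis
      using ideal_prod_mono[OF order_refl] ideal_pow_add[OF K, of d n] by (simp add: add.commute)
  qed
  show ?thesis
  proof (induct n arbitrary: d)
    case 0
    then show ?case using *[of d 0] by simp
  next
    case (Suc n)
    then show ?case unfolding denom_forms.simps
      using set_add_least[OF ideal_pow_ideal[OF K] _ *] by (metis add_Suc_shift)
  qed
qed

text \<open>For d = 1 the sum has the shape of the lower terms in an equation of integral dependence
  of degree n + 1.\<close>

lemma denom_forms_elem:
  assumes "f \<in> denom_forms y z K n d"
  shows "\<exists>c. (\<forall>i\<in>{d..n + d}. c i \<in> ideal_pow R K i) \<and>
    f = y \<otimes> (\<Oplus>i\<in>{d..n + d}. c i \<otimes> z [^] (n + d - i))"
  using assms
proof (induct n arbitrary: d f)
  case 0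
  then obtain a where "a \<in> ideal_pow R K d" "f = y \<otimes> a"
    using ideal_prod_cgenideal[OF ideal_pow_ideal[OF K] y] by auto
  then show ?case using ideal_pow_carrier[OF K] by (intro exI[of _ "\<lambda>_. a"]) simp
next
  case (Suc n)
  then obtain g h where gh: "g \<in> denom_forms y z K n (Suc d)"
    "h \<in> ideal_pow R K d \<cdot> (PIdl (y \<otimes> z [^] Suc n))" "f = g \<oplus> h"
    unfolding denom_forms.simps mem_set_add_iff by blast
  obtain c where c: "\<forall>i\<in>{Suc d..n + Suc d}. c i \<in> ideal_pow R K i"
    "g = y \<otimes> (\<Oplus>i\<in>{Suc d..n + Suc d}. c i \<otimes> z [^] (n + Suc d - i))"
    using Suc(1)[OF gh(1)] by blast
  obtain a where a: "a \<in> ideal_pow R K d" "h = (y \<otimes> z [^] Suc n) \<otimes> a"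
    using gh(2) ideal_prod_cgenideal[OF ideal_pow_ideal[OF K], of "y \<otimes> z [^] Suc n"] by auto
  have ac [simp]: "a \<in> carrier R" using ideal_pow_carrier[OF K a(1)] .
  have cc: "i \<in> {Suc d..n + Suc d} \<Longrightarrow> c i \<in> carrier R" for i using c ideal_pow_carrier[OF K] by blast
  define e where "e = c(d := a)"
  let ?s = "\<Oplus>i\<in>{Suc d..n + Suc d}. c i \<otimes> z [^] (n + Suc d - i)"
  have s: "?s \<in> carrier R" using cc by (intro finsum_closed) auto
  have "{d..Suc n + d} = insert d {Suc d..n + Suc d}" by auto
  then have "(\<Oplus>i\<in>{d..Suc n + d}. e i \<otimes> z [^] (Suc n + d - i)) =
      (\<Oplus>i\<in>insert d {Suc d..n + Suc d}. e i \<otimes> z [^] (n + Suc d - i))" by simp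
  also have "\<dots> = e d \<otimes> z [^] (n + Suc d - d) \<oplus> (\<Oplus>i\<in>{Suc d..n + Suc d}. e i \<otimes> z [^] (n + Suc d - i))"
    using cc by (intro finsum_insert) (auto simp: e_def)
  also have "(\<Oplus>i\<in>{Suc d..n + Suc d}. e i \<otimes> z [^] (n + Suc d - i)) = ?s"
    using cc by (intro finsum_cong') (auto simp: e_def)
  finally have eq: "(\<Oplus>i\<in>{d..Suc n + d}. e i \<otimes> z [^] (Suc n + d - i)) = a \<otimes> z [^] Suc n \<oplus> ?s"
    by (simp add: e_def)
  have "f = y \<otimes> (a \<otimes> z [^] Suc n \<oplus> ?s)"
    unfolding gh(3) c(2) a(2) using s by (simp add: r_distr m_ac a_ac)
  moreover have "\<forall>i\<in>{d..Suc n + d}. e i \<in> ideal_pow R K i" using c(1) a(1) by (auto simp: e_def)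
  ultimately show ?case using eq by metis
qed

text \<open>
  Graded Noetherianity of \<open>\<Sum>\<^bsub>j\<le>n\<^esub> y z\<^sup>j K\<^bsup>n-j\<^esup>\<close> replaces the determinant trick.
\<close>

lemma integral_of_bounded_denominator:
  assumes "nonzerodivisor y" and pow: "\<And>n. y \<otimes> z [^] n \<in> ideal_pow R K n"
  shows "z \<in> ideal_integral_closure R K"
proof -
  have "denom_forms y z K n (Suc 0) \<subseteq> denom_forms y z K (Suc n) 0" for n
    unfolding denom_forms.simps
    by (intro set_add_upper denom_forms_ideal ideal_prod_is_ideal ideal_pow_ideal[OF K] cgenideal_ideal) simp
  then have "graded_family K (\<lambda>n. denom_forms y z K n 0)"
    using denom_forms_ideal denom_forms_prod denom_forms_subset[OF pow, of _ 0]
    unfolding graded_family_def by fastforce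
  \<comment> \<open>In such a degree nothing new appears: y z^(n+1) can be rewritten with lower
    powers of \<open>z\<close> only, the power z^(n+1-i) having its coefficient in K^i.\<close>
  then obtain n where "denom_forms y z K (Suc n) 0 \<subseteq> K \<cdot> denom_forms y z K n 0"
    using graded_family_generated[OF K] by blast
  then have n: "denom_forms y z K (Suc n) 0 \<subseteq> denom_forms y z K n (Suc 0)"
    using denom_forms_prod by blast
  have "y \<otimes> z [^] Suc n \<in> ideal_pow R K 0 \<cdot> (PIdl (y \<otimes> z [^] Suc n))"
    using ideal_prod.prod[of \<one> "ideal_pow R K 0" "y \<otimes> z [^] Suc n" "PIdl (y \<otimes> z [^] Suc n)" R]
      cgenideal_self[of "y \<otimes> z [^] Suc n"] by simp
  moreover have "\<dots> \<subseteq> denom_forms y z K (Suc n) 0"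
    unfolding denom_forms.simps
    by (intro set_add_upper denom_forms_ideal ideal_prod_is_ideal ideal_pow_ideal[OF K] cgenideal_ideal) simp
  ultimately have "y \<otimes> z [^] Suc n \<in> denom_forms y z K n (Suc 0)" using n by blast
  from denom_forms_elem[OF this] obtain c where c: "\<forall>i\<in>{1..Suc n}. c i \<in> ideal_pow R K i"
    "y \<otimes> z [^] Suc n = y \<otimes> (\<Oplus>i\<in>{1..Suc n}. c i \<otimes> z [^] (Suc n - i))"
    by auto
  have cc: "i \<in> {1..Suc n} \<Longrightarrow> c i \<in> carrier R" for i using c ideal_pow_carrier[OF K] by blast
  let ?s = "\<Oplus>i\<in>{1..Suc n}. c i \<otimes> z [^] (Suc n - i)"
  let ?t = "\<Oplus>i\<in>{1..Suc n}. (\<ominus> c i) \<otimes> z [^] (Suc n - i)"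
  have "?s \<in> carrier R" using cc by (intro finsum_closed) auto
  \<comment> \<open>Cancelling \<open>y\<close> leaves the integral equation; \<open>?t\<close>
    moves the signs into the coefficients.\<close>
  then have "z [^] Suc n = ?s" by (intro nonzerodivisor_cancel[OF assms(1) _ _ c(2)]) auto
  moreover have "?s \<oplus> ?t = (\<Oplus>i\<in>{1..Suc n}. c i \<otimes> z [^] (Suc n - i) \<oplus> (\<ominus> c i) \<otimes> z [^] (Suc n - i))"
    using cc by (intro finsum_addf[symmetric]) auto
  moreover have "\<dots> = (\<Oplus>i\<in>{1..Suc n}. \<zero>)"
    using cc by (intro finsum_cong') (auto simp: r_neg simp flip: l_distr)
  ultimately have eq: "z [^] Suc n \<oplus> ?t = \<zero>" by (simp add: finsum_zero del: nat_pow_Suc)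
  have "\<forall>i\<in>{1..Suc n}. \<ominus> c i \<in> ideal_pow R K i"
    using c(1) ideal_uminus[OF ideal_pow_ideal[OF K]] by blast
  then show ?thesis
    unfolding ideal_integral_closure_def using eq z
    by (intro CollectI conjI exI[of _ "Suc n"] exI[of _ "\<lambda>i. \<ominus> c i"]) auto
qed

end

end

section \<open>Artinian quotients\<close>

context cring
begin

lemma maximalideal_comaximal:
  assumes "maximalideal J R" "a \<in> carrier R" "a \<notin> J"
  shows "\<exists>\<mu>\<in>J. \<exists>b\<in>carrier R. \<one> = \<mu> \<oplus> a \<otimes> b"
proof -
  have J: "ideal J R" using assms(1) by (rule maximalideal.axioms(1))
  let ?S = "J <+> PIdl a"
  have S: "ideal ?S R" by (rule add_ideals[OF J cgenideal_ideal[OF assms(2)]])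
  have "J \<subseteq> ?S" "a \<in> ?S"
    using set_add_upper[OF J cgenideal_ideal[OF assms(2)]] cgenideal_self[OF assms(2)] by auto
  then have "?S = carrier R"
    using maximalideal.I_maximal[OF assms(1) S] ideal_in_carrier[OF S] assms(3) by blast
  then show ?thesis unfolding mem_set_add_iff using one_closed mem_cgenideal_iff[OF assms(2)]
    by (metis mem_set_add_iff)
qed

end

context noetherian_cring
begin

text \<open>Choose \<open>s\<close> outside \<open>Q\<close> with (Q : s) maximal. If t s is not in
  \<open>Q\<close>, maximality keeps (Q : t^n s) equal to (Q : s) for all n, so no power of
  \<open>t\<close> kills \<open>s\<close> modulo \<open>Q\<close>.\<close>

lemma exists_socle_element:
  assumes Q: "ideal Q R" "Q \<noteq> carrier R" and J: "J \<subseteq> carrier R" "\<And>t. t \<in> J \<Longrightarrow> \<exists>n::nat. t [^] n \<in> Q"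
  shows "\<exists>s\<in>carrier R - Q. \<forall>t\<in>J. t \<otimes> s \<in> Q"
proof -
  define D where "D = {ideal_colon R Q {s} |s. s \<in> carrier R - Q}"
  have "D \<noteq> {}" using ideal_in_carrier[OF Q(1)] Q(2) by (auto simp: D_def)
  moreover have "ideal L R" if "L \<in> D" for L
    using that ideal_colon_ideal[OF Q(1)] by (auto simp: D_def)
  ultimately obtain L where "L \<in> D" and max: "\<And>L'. L' \<in> D \<Longrightarrow> L \<subseteq> L' \<Longrightarrow> L' = L"
    using maximal_ideal_in_family[of D] by metis
  then obtain s where s: "s \<in> carrier R" "s \<notin> Q" and L: "L = ideal_colon R Q {s}" by (auto simp: D_def)
  have "t \<otimes> s \<in> Q" if t: "t \<in> J" for t
  proof (rule ccontr)
    assume ts: "t \<otimes> s \<notin> Q"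
    have tc: "t \<in> carrier R" using t J by blast
    have notin: "t [^] n \<otimes> s \<notin> Q" for n :: nat
    proof (induct n)
      case 0
      then show ?case using s by simp
    next
      case (Suc n)
      let ?s = "t [^] n \<otimes> s"
      have "L \<subseteq> ideal_colon R Q {?s}"
      proof
        fix a assume "a \<in> L"
        then have "a \<in> carrier R" "a \<otimes> s \<in> Q" by (auto simp: L mem_ideal_colon_iff)
        then have "t [^] n \<otimes> (a \<otimes> s) \<in> Q" using ideal_lmult[OF Q(1)] tc by simp
        then show "a \<in> ideal_colon R Q {?s}"
          using \<open>a \<in> carrier R\<close> s tc by (simp add: mem_ideal_colon_iff m_lcomm)
      qed
      moreover have "ideal_colon R Q {?s} \<in> D" using Suc s tc by (auto simp: D_def)
      ultimately have "ideal_colon R Q {?s} = L" using max by blast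
      then have "t \<notin> ideal_colon R Q {?s}" using ts tc by (simp add: L mem_ideal_colon_iff)
      then show ?case using tc s by (simp add: mem_ideal_colon_iff m_ac)
    qed
    obtain n :: nat where "t [^] n \<in> Q" using J(2)[OF t] by blast
    then show False using notin[of n] ideal_rmult[OF Q(1)] s(1) by blast
  qed
  then show ?thesis using s by blast
qed

text \<open>Noetherian induction: a maximal bad \<open>Q\<close> is enlarged by a socle element
  \<open>s\<close>. Since (Q + (s))/Q is a simple module, the chain is determined by its image
  modulo Q + (s) together with whether it contains \<open>s\<close>.\<close>

lemma descending_chain_stable:
  fixes F :: "nat \<Rightarrow> 'a set"
  assumes \<mm>: "maximalideal \<mm> R" and Q: "ideal Q R" "\<And>t. t \<in> \<mm> \<Longrightarrow> \<exists>n::nat. t [^] n \<in> Q"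
    and F: "\<And>i. ideal (F i) R" "\<And>i. Q \<subseteq> F i" "\<And>i. F (Suc i) \<subseteq> F i"
  shows "\<exists>i0. \<forall>i\<ge>i0. F i = F i0"
proof -
  define artin where "artin Q \<longleftrightarrow>
    (\<forall>F :: nat \<Rightarrow> 'a set. (\<forall>i. ideal (F i) R \<and> Q \<subseteq> F i \<and> F (Suc i) \<subseteq> F i) \<longrightarrow> (\<exists>i0. \<forall>i\<ge>i0. F i = F i0))"
    for Q
  define C where "C = {Q. ideal Q R \<and> (\<forall>t\<in>\<mm>. \<exists>n::nat. t [^] n \<in> Q) \<and> \<not> artin Q}"
  have "C = {}"
  proof (rule ccontr)
    assume "C \<noteq> {}"
    moreover have "L \<in> C \<Longrightarrow> ideal L R" for L by (simp add: C_def)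
    ultimately obtain Q where "Q \<in> C" and max: "\<And>L. L \<in> C \<Longrightarrow> Q \<subseteq> L \<Longrightarrow> L = Q"
      using maximal_ideal_in_family[of C] by metis
    then have Q: "ideal Q R" "\<And>t. t \<in> \<mm> \<Longrightarrow> \<exists>n::nat. t [^] n \<in> Q" and "\<not> artin Q"
      unfolding C_def by auto
    then obtain F where F: "\<And>i. ideal (F i) R" "\<And>i. Q \<subseteq> F i" "\<And>i. F (Suc i) \<subseteq> F i"
      and bad: "\<nexists>i0. \<forall>i\<ge>i0. F i = F i0" unfolding artin_def by blast
    have anti: "i \<le> i' \<Longrightarrow> F i' \<subseteq> F i" for i i' using F(3) by (rule lift_Suc_antimono_le)
    have Fc: "F i \<subseteq> carrier R" for i using ideal_in_carrier[OF F(1)] .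
    have "Q \<noteq> carrier R" using bad F(2) Fc by (metis subset_antisym)
    moreover have "\<mm> \<subseteq> carrier R" using ideal_in_carrier[OF maximalideal.axioms(1)[OF \<mm>]] .
    ultimately have "\<exists>s\<in>carrier R - Q. \<forall>t\<in>\<mm>. t \<otimes> s \<in> Q"
      by (rule exists_socle_element[OF Q(1) _ _ Q(2)])
    then obtain s where s: "s \<in> carrier R" "s \<notin> Q" "\<And>t. t \<in> \<mm> \<Longrightarrow> t \<otimes> s \<in> Q" by auto
    let ?S = "Q <+> PIdl s"
    have S: "ideal ?S R" by (rule add_ideals[OF Q(1) cgenideal_ideal[OF s(1)]])
    have QS: "Q \<subseteq> ?S" "s \<in> ?S"
      using set_add_upper[OF Q(1) cgenideal_ideal[OF s(1)]] cgenideal_self[OF s(1)] by auto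
    have "?S \<notin> C" using max[of ?S] QS s(2) by blast
    then have "artin ?S" using S Q(2) QS(1) unfolding C_def by blast
    moreover have "ideal (F i <+> ?S) R \<and> ?S \<subseteq> F i <+> ?S \<and> F (Suc i) <+> ?S \<subseteq> F i <+> ?S" for i
      using add_ideals[OF F(1) S] set_add_upper[OF F(1) S] set_add_mono[OF F(3) order_refl] by blast
    ultimately have "\<exists>i0. \<forall>i\<ge>i0. F i <+> ?S = F i0 <+> ?S"
      unfolding artin_def by (elim allE[of _ "\<lambda>i. F i <+> ?S"]) simp
    then obtain i1 where i1: "\<And>i. i \<ge> i1 \<Longrightarrow> F i <+> ?S = F i1 <+> ?S" by blast
    \<comment> \<open>The chain descends, so once \<open>s\<close> has left it, \<open>s\<close>
      stays out.\<close>
    obtain i2 where i2: "(\<forall>i. s \<in> F i) \<or> (\<forall>i\<ge>i2. s \<notin> F i)" using anti by blast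
    have "F i = F (max i1 i2)" if i: "i \<ge> max i1 i2" for i
    proof
      let ?i = "max i1 i2"
      show "F i \<subseteq> F ?i" using anti[OF i] .
      show "F ?i \<subseteq> F i"
      proof
        fix f assume f: "f \<in> F ?i"
        have "F ?i <+> ?S = F i <+> ?S" using i1[of i] i1[of ?i] i by simp
        then have "f \<in> F i <+> ?S" using f set_add_upper(1)[OF F(1) S] by blast
        then obtain g t where g: "g \<in> F i" "t \<in> ?S" "f = g \<oplus> t"
          using mem_set_add_iff[of f "F i" ?S] by blast
        obtain q v where qv: "q \<in> Q" "v \<in> PIdl s" "t = q \<oplus> v"
          using g(2) by (auto simp only: mem_set_add_iff)
        then obtain b where "b \<in> carrier R" "v = s \<otimes> b" using mem_cgenideal_iff[OF s(1)] by auto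
        then have q: "q \<in> Q" "b \<in> carrier R" "t = q \<oplus> s \<otimes> b" using qv by auto
        have carr: "g \<in> carrier R" "q \<in> carrier R" "s \<otimes> b \<in> carrier R"
          using g(1) q(1,2) s(1) Fc F(2) by blast+
        have "s \<otimes> b = f \<ominus> (g \<oplus> q)" unfolding g(3) q(3) using carr by algebra
        moreover have "g \<oplus> q \<in> F ?i" using g(1) q(1) anti[OF i] F(2) ideal_add[OF F(1)] by blast
        ultimately have sb: "s \<otimes> b \<in> F ?i" using f ideal_minus[OF F(1)] by simp
        have "s \<otimes> b \<in> F i"
        proof (cases "\<forall>i. s \<in> F i")
          case True
          then show ?thesis using ideal_rmult[OF F(1)] q(2) by blast
        next
          case False
          then have ns: "s \<notin> F ?i" using i2 by auto
          \<comment> \<open>Otherwise \<open>b\<close> is invertible modulo \<open>\<mm>\<close>; as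
            \<open>\<mm>\<close> kills \<open>s\<close> modulo \<open>Q\<close>, the element s b
            would bring \<open>s\<close> itself into the chain.\<close>
          have "b \<in> \<mm>"
          proof (rule ccontr)
            assume "b \<notin> \<mm>"
            then obtain \<mu> c where c: "\<mu> \<in> \<mm>" "c \<in> carrier R" "\<one> = \<mu> \<oplus> b \<otimes> c"
              using maximalideal_comaximal[OF \<mm> q(2)] by blast
            have mc: "\<mu> \<in> carrier R" using c(1) ideal.Icarr[OF maximalideal.axioms(1)[OF \<mm>]] by blast
            have "s = (\<mu> \<oplus> b \<otimes> c) \<otimes> s" using s(1) c(3) by (metis l_one)
            also have "\<dots> = \<mu> \<otimes> s \<oplus> (s \<otimes> b) \<otimes> c" using mc s(1) c(2) q(2) by algebra
            finally have "s = \<mu> \<otimes> s \<oplus> (s \<otimes> b) \<otimes> c" .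
            moreover have "\<mu> \<otimes> s \<in> F ?i" using s(3)[OF c(1)] F(2) by blast
            moreover have "(s \<otimes> b) \<otimes> c \<in> F ?i" using sb c(2) ideal_rmult[OF F(1)] by blast
            ultimately show False using ns ideal_add[OF F(1)] by metis
          qed
          then have "b \<otimes> s \<in> F i" using s(3) F(2) by blast
          then show ?thesis using m_comm[OF s(1) q(2)] by simp
        qed
        then show "f \<in> F i" unfolding g(3) q(3) using g(1) q(1) F(2) ideal_add[OF F(1)] by blast
      qed
    qed
    then show False using bad by blast
  qed
  then have "artin Q" using Q unfolding C_def by blast
  then show ?thesis unfolding artin_def using F by blast
qed

end

section \<open>Colon ideals modulo a superficial element\<close>

text \<open>The consequences of the local hypotheses that drive the argument. Cancellation of
  \<open>x\<close> is required without the intersection with I^c, and depth appears as a regular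
  pair inside every power of \<open>I\<close>.\<close>

locale superficial_element = noetherian_cring R + I: ideal I R for R (structure) and I and x +
  assumes x_mem: "x \<in> I"
    and superficial_cancel:
      "\<exists>c. \<forall>n\<ge>c. \<forall>z\<in>carrier R. x \<otimes> z \<in> ideal_pow R I (Suc n) \<longrightarrow> z \<in> ideal_pow R I n"
    and grade_ge_2: "\<exists>p q. p \<in> ideal_pow R I n \<and> q \<in> ideal_pow R I n \<and> nonzerodivisor p \<and>
      (\<forall>a\<in>carrier R. q \<otimes> a \<in> PIdl p \<longrightarrow> a \<in> PIdl p)"
begin

declare nat_pow_Suc [simp del] Group.nat_pow_Suc [simp del]

section \<open>Arithmetic of the ideals (x^r) + I^n\<close>

abbreviation I_pow :: "nat \<Rightarrow> 'a set"
  where "I_pow n \<equiv> ideal_pow R I n"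

abbreviation x_plus :: "nat \<Rightarrow> nat \<Rightarrow> 'a set"
  where "x_plus r n \<equiv> PIdl (x [^] r) <+> I_pow n"

lemma x_carrier [simp]: "x \<in> carrier R"
  using x_mem I.Icarr by blast

lemma I_pow_ideal: "ideal (I_pow n) R"
  using I.is_ideal by (rule ideal_pow_ideal)

lemma I_pow_carrier: "a \<in> I_pow n \<Longrightarrow> a \<in> carrier R"
  using ideal_pow_carrier[OF I.is_ideal] .

lemma I_pow_antimonoD: "a \<in> I_pow n \<Longrightarrow> m \<le> n \<Longrightarrow> a \<in> I_pow m"
  using ideal_pow_antimonoD[OF _ I.is_ideal] .

lemma I_pow_mult: "a \<in> I_pow m \<Longrightarrow> b \<in> I_pow n \<Longrightarrow> a \<otimes> b \<in> I_pow (m + n)"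
  using ideal_pow_mult[OF I.is_ideal] .

lemma mem_I_pow_1: "a \<in> I_pow (Suc 0) \<longleftrightarrow> a \<in> I"
  by (simp only: ideal_pow_1[OF I.is_ideal])

lemma x_mult: "a \<in> I_pow n \<Longrightarrow> x \<otimes> a \<in> I_pow (Suc n)"
  using I_pow_mult[of x "Suc 0" a n] x_mem by (simp only: mem_I_pow_1 add_Suc add_0)

lemma x_pow_mem: "x [^] r \<in> I_pow r"
  using ideal_pow_elem_pow[OF I.is_ideal, of x "Suc 0" r] x_mem
  by (simp only: mem_I_pow_1 mult_Suc mult_0 add_0_right)

lemma x_plus_ideal: "ideal (x_plus r n) R"
  by (intro add_ideals cgenideal_ideal I_pow_ideal) simp

lemma mem_x_plus: "z \<in> x_plus r n \<longleftrightarrow> (\<exists>b\<in>carrier R. \<exists>i\<in>I_pow n. z = x [^] r \<otimes> b \<oplus> i)"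
  unfolding mem_set_add_iff using mem_cgenideal_iff[of "x [^] r"] by (simp add: Bex_def) blast

lemma x_plusI: "b \<in> carrier R \<Longrightarrow> i \<in> I_pow n \<Longrightarrow> x [^] r \<otimes> b \<oplus> i \<in> x_plus r n"
  unfolding mem_x_plus by blast

lemma mem_x_plus_1: "z \<in> x_plus (Suc 0) n \<longleftrightarrow> (\<exists>b\<in>carrier R. \<exists>i\<in>I_pow n. z = x \<otimes> b \<oplus> i)"
  unfolding mem_x_plus by (simp add: nat_pow_Suc)

lemma x_plus_I_pow: "I_pow n \<subseteq> x_plus r n"
  by (intro set_add_upper cgenideal_ideal I_pow_ideal) simp

lemma x_plus_antimono:
  assumes "r' \<le> r" "n' \<le> n"
  shows "x_plus r n \<subseteq> x_plus r' n'"
proof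
  fix z assume "z \<in> x_plus r n"
  then obtain b i where *: "b \<in> carrier R" "i \<in> I_pow n" "z = x [^] r \<otimes> b \<oplus> i"
    unfolding mem_x_plus by blast
  have "x [^] r = x [^] r' \<otimes> x [^] (r - r')" using nat_pow_mult[of x r' "r - r'"] assms(1) by simp
  then have "z = x [^] r' \<otimes> (x [^] (r - r') \<otimes> b) \<oplus> i" using * by (simp add: m_assoc)
  moreover have "i \<in> I_pow n'" using I_pow_antimonoD[OF *(2) assms(2)] .
  ultimately show "z \<in> x_plus r' n'" using x_plusI[of "x [^] (r - r') \<otimes> b" i n' r'] *(1) by simp
qed

lemma x_plus_mult:
  assumes "a \<in> x_plus r m" "b \<in> x_plus r n"
  shows "a \<otimes> b \<in> x_plus r (m + n)"
proof -
  obtain c i where 1: "c \<in> carrier R" "i \<in> I_pow m" "a = x [^] r \<otimes> c \<oplus> i"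
    using assms(1) unfolding mem_x_plus by blast
  obtain d j where 2: "d \<in> carrier R" "j \<in> I_pow n" "b = x [^] r \<otimes> d \<oplus> j"
    using assms(2) unfolding mem_x_plus by blast
  have [simp]: "i \<in> carrier R" "j \<in> carrier R" using 1 2 I_pow_carrier by blast+
  define y where "y = x [^] r"
  have [simp]: "y \<in> carrier R" by (simp add: y_def)
  have "(y \<otimes> c \<oplus> i) \<otimes> (y \<otimes> d \<oplus> j) = y \<otimes> (c \<otimes> (y \<otimes> d \<oplus> j) \<oplus> i \<otimes> d) \<oplus> i \<otimes> j"
    using 1(1) 2(1) \<open>i \<in> carrier R\<close> \<open>j \<in> carrier R\<close> \<open>y \<in> carrier R\<close> by algebra
  then show ?thesis
    using x_plusI[of "c \<otimes> (y \<otimes> d \<oplus> j) \<oplus> i \<otimes> d" "i \<otimes> j" "m + n" r] I_pow_mult[OF 1(2) 2(2)] 1 2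
    unfolding y_def by simp
qed

lemma x_plus_mult_I_pow: "a \<in> x_plus r m \<Longrightarrow> b \<in> I_pow n \<Longrightarrow> a \<otimes> b \<in> x_plus r (m + n)"
  using x_plus_mult x_plus_I_pow by blast

text \<open>Depth two enters here. Multiplying \<open>z\<close> by a regular pair \<open>p\<close>,
  \<open>q\<close> in \<open>I\<close> gives two relations modulo \<open>x\<close>; eliminating
  \<open>z\<close> between them yields a relation between \<open>p\<close> and \<open>q\<close>,
  whose regularity exhibits \<open>z\<close> as a multiple of \<open>x\<close> up to a bounded loss
  of order.\<close>

lemma colon_I_bounded_drop:
  "\<exists>k. \<forall>m. ideal_colon R (x_plus (Suc 0) (m + k)) I \<subseteq> x_plus (Suc 0) m"
proof -
  obtain p q where pq: "p \<in> I" "q \<in> I" "nonzerodivisor p"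
    "\<And>a. a \<in> carrier R \<Longrightarrow> q \<otimes> a \<in> PIdl p \<Longrightarrow> a \<in> PIdl p"
    using grade_ge_2[of "Suc 0"] unfolding mem_I_pow_1 by blast
  have [simp]: "p \<in> carrier R" "q \<in> carrier R" using pq I.Icarr by blast+
  have P: "ideal (PIdl p) R" and Q: "ideal (PIdl q) R" by (simp_all add: cgenideal_ideal)
  obtain c where c: "\<And>n z. n \<ge> c \<Longrightarrow> z \<in> carrier R \<Longrightarrow> x \<otimes> z \<in> I_pow (Suc n) \<Longrightarrow> z \<in> I_pow n"
    using superficial_cancel by blast
  obtain k1 where k1: "\<And>n. I_pow (n + k1) \<inter> (PIdl q <+> PIdl p) \<subseteq> I_pow n \<cdot> (PIdl q <+> PIdl p)"
    using artin_rees[OF I.is_ideal add_ideals[OF Q P]] by blast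
  obtain k2 where k2: "\<And>n z. z \<in> carrier R \<Longrightarrow> p \<otimes> z \<in> I_pow (n + k2) \<Longrightarrow> z \<in> I_pow n"
    using artin_rees_nonzerodivisor[OF I.is_ideal pq(3)] by blast
  \<comment> \<open>The total loss: one for cancelling \<open>x\<close>, \<open>c\<close> to be in
    the range where this is allowed, \<open>k1\<close> and \<open>k2\<close> for the two uses of
    Artin-Rees.\<close>
  define k where "k = Suc (c + k1 + k2)"
  have "z \<in> x_plus (Suc 0) m" if z: "z \<in> ideal_colon R (x_plus (Suc 0) (m + k)) I" for z m
  proof -
    have zc [simp]: "z \<in> carrier R" using z by (simp add: mem_ideal_colon_iff)
    define M where "M = m + c + k1 + k2"
    have Mk: "m + k = Suc M" by (simp add: M_def k_def)
    obtain \<alpha> i where a: "\<alpha> \<in> carrier R" "i \<in> I_pow (Suc M)" "z \<otimes> p = x \<otimes> \<alpha> \<oplus> i"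
      using z pq(1) unfolding Mk mem_ideal_colon_iff mem_x_plus_1 by blast
    obtain \<beta> i' where b: "\<beta> \<in> carrier R" "i' \<in> I_pow (Suc M)" "z \<otimes> q = x \<otimes> \<beta> \<oplus> i'"
      using z pq(2) unfolding Mk mem_ideal_colon_iff mem_x_plus_1 by blast
    note carr = a(1) b(1) I_pow_carrier[OF a(2)] I_pow_carrier[OF b(2)] zc x_carrier
      \<open>p \<in> carrier R\<close> \<open>q \<in> carrier R\<close>
    \<comment> \<open>Compute z p q in two ways.\<close>
    have "x \<otimes> (\<alpha> \<otimes> q \<ominus> \<beta> \<otimes> p) = (x \<otimes> \<alpha> \<oplus> i) \<otimes> q \<ominus> (x \<otimes> \<beta> \<oplus> i') \<otimes> p \<oplus> (i' \<otimes> p \<ominus> i \<otimes> q)"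
      using carr by algebra
    also have "\<dots> = (z \<otimes> p) \<otimes> q \<ominus> (z \<otimes> q) \<otimes> p \<oplus> (i' \<otimes> p \<ominus> i \<otimes> q)" using a b by simp
    also have "\<dots> = i' \<otimes> p \<ominus> i \<otimes> q" using carr by algebra
    also have "\<dots> \<in> I_pow (Suc M)"
      using a(2) b(2) by (intro ideal_minus[OF I_pow_ideal] ideal_rmult[OF I_pow_ideal]) simp_all
    finally have "\<alpha> \<otimes> q \<ominus> \<beta> \<otimes> p \<in> I_pow M" using c[of M] carr by (simp add: M_def)
    moreover have "\<alpha> \<otimes> q \<ominus> \<beta> \<otimes> p = q \<otimes> \<alpha> \<oplus> p \<otimes> (\<ominus> \<beta>)" using carr by algebra
    moreover have "q \<otimes> \<alpha> \<oplus> p \<otimes> (\<ominus> \<beta>) \<in> PIdl q <+> PIdl p"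
      using carr by (intro set_addI) (auto simp: mem_cgenideal_iff)
    moreover have "M = (m + c + k2) + k1" by (simp add: M_def)
    ultimately have "\<alpha> \<otimes> q \<ominus> \<beta> \<otimes> p \<in> I_pow (m + c + k2) \<cdot> (PIdl q <+> PIdl p)"
      using k1[of "m + c + k2"] by auto
    then have "\<alpha> \<otimes> q \<ominus> \<beta> \<otimes> p \<in> I_pow (m + c + k2) \<cdot> (PIdl q) <+> I_pow (m + c + k2) \<cdot> (PIdl p)"
      using ideal_prod_r_distr[OF I_pow_ideal Q P] by simp
    then obtain j j' where j: "j \<in> I_pow (m + c + k2)" "j' \<in> I_pow (m + c + k2)"
      "\<alpha> \<otimes> q \<ominus> \<beta> \<otimes> p = q \<otimes> j \<oplus> p \<otimes> j'"
      unfolding mem_set_add_iff using ideal_prod_cgenideal[OF I_pow_ideal] by auto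
    note carr = carr I_pow_carrier[OF j(1)] I_pow_carrier[OF j(2)]
    \<comment> \<open>Correcting \<open>\<alpha>\<close> by the high-order element \<open>j\<close>
      turns the approximate relation into an exact one, to which regularity of \<open>q\<close>
      modulo \<open>p\<close> applies.\<close>
    have "q \<otimes> (\<alpha> \<ominus> j) = (\<alpha> \<otimes> q \<ominus> \<beta> \<otimes> p) \<oplus> \<beta> \<otimes> p \<ominus> q \<otimes> j" using carr by algebra
    also have "\<dots> = p \<otimes> (\<beta> \<oplus> j')" unfolding j(3) using carr by algebra
    finally have "q \<otimes> (\<alpha> \<ominus> j) \<in> PIdl p" using carr by (auto simp: mem_cgenideal_iff)
    then have "\<alpha> \<ominus> j \<in> PIdl p" by (rule pq(4)[rotated]) (use carr in simp)
    then obtain \<gamma> where g: "\<gamma> \<in> carrier R" "\<alpha> \<ominus> j = p \<otimes> \<gamma>" using mem_cgenideal_iff[of p] by auto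
    have "p \<otimes> (z \<ominus> x \<otimes> \<gamma>) = z \<otimes> p \<ominus> x \<otimes> (p \<otimes> \<gamma>)" using carr g(1) by algebra
    also have "\<dots> = x \<otimes> j \<oplus> i" unfolding a(3) g(2)[symmetric] using carr by algebra
    also have "\<dots> \<in> I_pow (m + k2)"
    proof (rule ideal_add[OF I_pow_ideal])
      show "x \<otimes> j \<in> I_pow (m + k2)"
        using ideal_lmult[OF I_pow_ideal I_pow_antimonoD[OF j(1)]] by simp
      show "i \<in> I_pow (m + k2)" using I_pow_antimonoD[OF a(2)] by (simp add: M_def)
    qed
    finally have "z \<ominus> x \<otimes> \<gamma> \<in> I_pow m" by (rule k2[rotated]) (use carr g(1) in simp)
    moreover have "z = x \<otimes> \<gamma> \<oplus> (z \<ominus> x \<otimes> \<gamma>)" using carr g(1) by algebra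
    ultimately show ?thesis unfolding mem_x_plus_1 using g(1) by blast
  qed
  then show ?thesis by blast
qed

text \<open>\<open>T m\<close> represents the elements of degree m in the associated graded ring of
  A/(x) that are killed by its degree-one part. Eventually T_m lies in I T_(m-1), which is zero in
  that graded ring by the definition of T_(m-1).\<close>

lemma colon_I_climb:
  "\<exists>e. \<forall>m\<ge>e. I_pow m \<inter> ideal_colon R (x_plus (Suc 0) (Suc (Suc m))) I \<subseteq> x_plus (Suc 0) (Suc m)"
proof -
  define T where "T m = I_pow m \<inter> ideal_colon R (x_plus (Suc 0) (Suc (Suc m))) I" for m
  have T: "ideal (T m) R" for m
    unfolding T_def
    by (intro i_intersect I_pow_ideal ideal_colon_ideal x_plus_ideal ideal_in_carrier I.is_ideal)
  have "I \<cdot> T m \<subseteq> T (Suc m)" for m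
    unfolding ideal_prod_subset_iff[OF T]
  proof (intro ballI)
    fix a t assume a: "a \<in> I" and t: "t \<in> T m"
    have c: "a \<in> carrier R" "t \<in> carrier R" using a t I.Icarr I_pow_carrier unfolding T_def by blast+
    have "a \<otimes> t \<in> I_pow (Suc m)"
      unfolding ideal_pow_Suc2[OF I.is_ideal] using a t by (auto simp: T_def intro: ideal_prod.prod)
    moreover have "a \<otimes> t \<otimes> w \<in> x_plus (Suc 0) (Suc (Suc (Suc m)))" if w: "w \<in> I" for w
    proof -
      have wc: "w \<in> carrier R" using w I.Icarr by blast
      have "t \<otimes> w \<in> x_plus (Suc 0) (Suc (Suc m))" using t w by (simp add: T_def mem_ideal_colon_iff)
      moreover have "a \<in> I_pow (Suc 0)" using a by (simp only: mem_I_pow_1)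
      ultimately have "t \<otimes> w \<otimes> a \<in> x_plus (Suc 0) (Suc (Suc m) + Suc 0)" by (rule x_plus_mult_I_pow)
      moreover have "t \<otimes> w \<otimes> a = a \<otimes> t \<otimes> w" using c wc by algebra
      ultimately show ?thesis by (simp only: add_Suc_right add_0_right)
    qed
    ultimately show "a \<otimes> t \<in> T (Suc m)" using c by (simp add: T_def mem_ideal_colon_iff)
  qed
  then have "graded_family I T" unfolding graded_family_def using T by (auto simp only: T_def)
  then obtain e where e: "\<And>m. m \<ge> e \<Longrightarrow> T (Suc m) \<subseteq> I \<cdot> T m"
    using graded_family_generated[OF I.is_ideal] by blast
  have "T m \<subseteq> x_plus (Suc 0) (Suc m)" if le: "m \<ge> Suc e" for m
  proof -
    obtain m' where m': "m = Suc m'" "m' \<ge> e" using le by (cases m) auto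
    have "I \<cdot> T m' \<subseteq> x_plus (Suc 0) (Suc m)"
      unfolding ideal_prod_subset_iff[OF x_plus_ideal]
    proof (intro ballI)
      fix a t assume "a \<in> I" "t \<in> T m'"
      then have "t \<otimes> a \<in> x_plus (Suc 0) (Suc m)" "a \<in> carrier R" "t \<in> carrier R"
        using I.Icarr by (simp_all add: T_def mem_ideal_colon_iff m')
      then show "a \<otimes> t \<in> x_plus (Suc 0) (Suc m)" by (simp add: m_comm)
    qed
    then show ?thesis using e[OF m'(2)] m'(1) by blast
  qed
  then show ?thesis unfolding T_def by blast
qed

text \<open>\<open>colon_I_bounded_drop\<close> loses at most \<open>k\<close> orders, and
  \<open>colon_I_climb\<close> recovers them one at a time. The threshold e + k keeps all orders of
  the climb at least \<open>e\<close>.\<close>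

lemma colon_I_eventually:
  "\<exists>h0. \<forall>m\<ge>h0. ideal_colon R (x_plus (Suc 0) (Suc m)) I \<subseteq> x_plus (Suc 0) m"
proof -
  obtain k where k: "\<And>m. ideal_colon R (x_plus (Suc 0) (m + k)) I \<subseteq> x_plus (Suc 0) m"
    using colon_I_bounded_drop by blast
  obtain e where e: "\<And>m. m \<ge> e \<Longrightarrow>
      I_pow m \<inter> ideal_colon R (x_plus (Suc 0) (Suc (Suc m))) I \<subseteq> x_plus (Suc 0) (Suc m)"
    using colon_I_climb by blast
  have "z \<in> x_plus (Suc 0) m" if m: "m \<ge> e + k" and z: "z \<in> ideal_colon R (x_plus (Suc 0) (Suc m)) I" for m z
  proof -
    have zc: "z \<in> carrier R" using z by (simp add: mem_ideal_colon_iff)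
    have "z \<in> x_plus (Suc 0) l" if "m - k \<le> l" "l \<le> m" for l
      using that
    proof (induct l rule: dec_induct)
      case base
      have "ideal_colon R (x_plus (Suc 0) (Suc m)) I \<subseteq> ideal_colon R (x_plus (Suc 0) (m - k + k)) I"
      proof
        fix a assume "a \<in> ideal_colon R (x_plus (Suc 0) (Suc m)) I"
        moreover have "x_plus (Suc 0) (Suc m) \<subseteq> x_plus (Suc 0) (m - k + k)"
          using m by (intro x_plus_antimono) auto
        ultimately show "a \<in> ideal_colon R (x_plus (Suc 0) (m - k + k)) I"
          unfolding mem_ideal_colon_iff by blast
      qed
      then show ?case using k[of "m - k"] z by blast
    next
      case (step l)
      then obtain b i where b: "b \<in> carrier R" "i \<in> I_pow l" "z = x \<otimes> b \<oplus> i"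
        unfolding mem_x_plus_1 by auto
      have ic: "i \<in> carrier R" using b I_pow_carrier by blast
      \<comment> \<open>Modulo \<open>x\<close> the elements \<open>i\<close> and \<open>z\<close>
        agree, so i w has order m + 1, which is at least l + 2 as l < m.\<close>
      have "i \<otimes> w \<in> x_plus (Suc 0) (Suc (Suc l))" if w: "w \<in> I" for w
      proof -
        have wc: "w \<in> carrier R" using w I.Icarr by blast
        have "z \<otimes> w \<in> x_plus (Suc 0) (Suc m)" using z w by (simp add: mem_ideal_colon_iff)
        then have "z \<otimes> w \<in> x_plus (Suc 0) (Suc (Suc l))"
          using x_plus_antimono[of "Suc 0" "Suc 0" "Suc (Suc l)" "Suc m"] step by auto
        moreover have "i \<otimes> w = x \<otimes> (\<ominus> (b \<otimes> w)) \<oplus> z \<otimes> w"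
          unfolding b(3) using b(1) ic wc x_carrier by algebra
        moreover have "x \<otimes> (\<ominus> (b \<otimes> w)) \<oplus> \<zero> \<in> x_plus (Suc 0) (Suc (Suc l))"
          unfolding mem_x_plus_1 using b(1) wc ideal_zero[OF I_pow_ideal] by blast
        ultimately show ?thesis
          using ideal_add[OF x_plus_ideal, of "x \<otimes> (\<ominus> (b \<otimes> w))"] b(1) wc by simp
      qed
      then have "i \<in> ideal_colon R (x_plus (Suc 0) (Suc (Suc l))) I"
        using ic by (simp add: mem_ideal_colon_iff)
      moreover have "e \<le> l" using m step by linarith
      ultimately have "i \<in> x_plus (Suc 0) (Suc l)" using e b(2) by blast
      then obtain b' i' where b': "b' \<in> carrier R" "i' \<in> I_pow (Suc l)" "i = x \<otimes> b' \<oplus> i'"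
        unfolding mem_x_plus_1 by blast
      have "z = x \<otimes> (b \<oplus> b') \<oplus> i'"
        unfolding b(3) b'(3) using b(1) b'(1) I_pow_carrier[OF b'(2)] x_carrier by algebra
      then show ?case unfolding mem_x_plus_1 using b(1) b'(1,2) by blast
    qed
    then show ?thesis by simp
  qed
  then show ?thesis by blast
qed

text \<open>Remove the factors of I^n one by one. Every order that occurs is at least
  \<open>h\<close>, so a threshold independent of \<open>n\<close> works.\<close>

lemma colon_I_pow_eventually:
  "\<exists>h0. \<forall>h\<ge>h0. \<forall>n. ideal_colon R (x_plus (Suc 0) (n + h)) (I_pow n) \<subseteq> x_plus (Suc 0) h"
proof -
  obtain h0 where h0: "\<And>m. m \<ge> h0 \<Longrightarrow> ideal_colon R (x_plus (Suc 0) (Suc m)) I \<subseteq> x_plus (Suc 0) m"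
    using colon_I_eventually by blast
  have "z \<in> x_plus (Suc 0) h" if h: "h \<ge> h0" and "z \<in> ideal_colon R (x_plus (Suc 0) (n + h)) (I_pow n)"
    for h n z
    using that(2)
  proof (induct n)
    case 0
    then have "z \<in> carrier R" and *: "\<forall>k\<in>carrier R. z \<otimes> k \<in> x_plus (Suc 0) h"
      by (simp_all add: mem_ideal_colon_iff)
    then show ?case using bspec[OF * one_closed] by simp
  next
    case (Suc n)
    then have zc: "z \<in> carrier R" by (simp add: mem_ideal_colon_iff)
    have "z \<otimes> w \<in> x_plus (Suc 0) (n + h)" if w: "w \<in> I_pow n" for w
    proof -
      have wc: "w \<in> carrier R" using w I_pow_carrier by blast
      have "z \<otimes> w \<otimes> v \<in> x_plus (Suc 0) (Suc (n + h))" if v: "v \<in> I" for v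
      proof -
        have "w \<otimes> v \<in> I_pow (Suc n)" unfolding ideal_pow_Suc using w v by (rule ideal_prod.prod)
        then have "z \<otimes> (w \<otimes> v) \<in> x_plus (Suc 0) (Suc n + h)"
          using Suc(2) by (simp only: mem_ideal_colon_iff)
        then show ?thesis using zc wc v I.Icarr by (simp add: m_assoc)
      qed
      then have "z \<otimes> w \<in> ideal_colon R (x_plus (Suc 0) (Suc (n + h))) I"
        using zc wc by (simp add: mem_ideal_colon_iff)
      then show ?thesis using h0[of "n + h"] h by auto
    qed
    then have "z \<in> ideal_colon R (x_plus (Suc 0) (n + h)) (I_pow n)" using zc by (simp add: mem_ideal_colon_iff)
    then show ?case by (rule Suc(1))
  qed
  then show ?thesis by blast
qed

end

section \<open>Elements divisible by powers of the superficial element\<close>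

context superficial_element
begin

text \<open>
  Geometrically, on the blowup of \<open>I\<close> with exceptional divisor \<open>E\<close>, these are the elements whose class
  in \<open>\<O>\<^bsub>hE\<^esub>\<close> is divisible by \<open>x\<^sup>r\<close>.
\<close>

definition divisible_sections :: "nat \<Rightarrow> nat \<Rightarrow> 'a set"
  where "divisible_sections h r = (\<Union>n. ideal_colon R (x_plus r (n + h)) (I_pow n))"

definition stable_from :: "nat \<Rightarrow> bool"
  where "stable_from h0 \<longleftrightarrow>
    (\<forall>n\<ge>h0. \<forall>z\<in>carrier R. x \<otimes> z \<in> I_pow (Suc n) \<longrightarrow> z \<in> I_pow n) \<and>
    (\<forall>h\<ge>h0. \<forall>n. ideal_colon R (x_plus (Suc 0) (n + h)) (I_pow n) \<subseteq> x_plus (Suc 0) h)"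

lemma exists_stable_from: "\<exists>h0. stable_from h0"
proof -
  obtain c where c: "\<forall>n\<ge>c. \<forall>z\<in>carrier R. x \<otimes> z \<in> I_pow (Suc n) \<longrightarrow> z \<in> I_pow n"
    using superficial_cancel by blast
  obtain h where h: "\<forall>h'\<ge>h. \<forall>n. ideal_colon R (x_plus (Suc 0) (n + h')) (I_pow n) \<subseteq> x_plus (Suc 0) h'"
    using colon_I_pow_eventually by blast
  have "stable_from (max c h)" unfolding stable_from_def using c h by simp
  then show ?thesis by blast
qed

lemma divisible_sections_carrier: "z \<in> divisible_sections h r \<Longrightarrow> z \<in> carrier R"
  by (auto simp: divisible_sections_def mem_ideal_colon_iff)

lemma divisible_sectionsI:
  assumes "z \<in> carrier R" "\<And>w. w \<in> I_pow n \<Longrightarrow> z \<otimes> w \<in> x_plus r (n + h)"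
  shows "z \<in> divisible_sections h r"
  using assms by (auto simp: divisible_sections_def mem_ideal_colon_iff)

lemma divisible_sectionsE:
  assumes "z \<in> divisible_sections h r"
  obtains n where "\<And>w. w \<in> I_pow n \<Longrightarrow> z \<otimes> w \<in> x_plus r (n + h)"
  using assms unfolding divisible_sections_def by (auto simp: mem_ideal_colon_iff)

lemma divisible_sections_antimono: "r' \<le> r \<Longrightarrow> divisible_sections h r \<subseteq> divisible_sections h r'"
  unfolding divisible_sections_def using x_plus_antimono[of r' r "n + h" "n + h" for n]
  by (fastforce simp: mem_ideal_colon_iff)

lemma I_pow_divisible_sections: "I_pow h \<subseteq> divisible_sections h r"
proof
  fix z assume z: "z \<in> I_pow h"
  show "z \<in> divisible_sections h r"
  proof (rule divisible_sectionsI[of z 0])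
    show "z \<in> carrier R" using I_pow_carrier[OF z] .
    show "z \<otimes> w \<in> x_plus r (0 + h)" if "w \<in> I_pow 0" for w
      using that ideal_rmult[OF I_pow_ideal z] x_plus_I_pow by auto
  qed
qed

lemma I_pow_prod_mem:
  assumes J: "ideal J R" and t: "t \<in> carrier R"
    and *: "\<And>u v. u \<in> I_pow m \<Longrightarrow> v \<in> I_pow n \<Longrightarrow> t \<otimes> (u \<otimes> v) \<in> J"
    and w: "w \<in> I_pow (m + n)"
  shows "t \<otimes> w \<in> J"
proof -
  have C: "ideal (ideal_colon R J {t}) R" using J t by (intro ideal_colon_ideal) auto
  have "I_pow m \<cdot> I_pow n \<subseteq> ideal_colon R J {t}"
    unfolding ideal_prod_subset_iff[OF C]
    using * t I_pow_carrier by (auto simp: mem_ideal_colon_iff m_comm)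
  then have "w \<otimes> t \<in> J" "w \<in> carrier R"
    using w unfolding ideal_pow_add[OF I.is_ideal] by (auto simp: mem_ideal_colon_iff)
  then show ?thesis using t m_comm by simp
qed

text \<open>Makes the union defining \<open>divisible_sections\<close> directed, as closure under
  addition requires: a further factor from I^k adds \<open>k\<close> to the order.\<close>

lemma colon_chain_mono:
  "ideal_colon R (x_plus r (n + h)) (I_pow n) \<subseteq> ideal_colon R (x_plus r (n + k + h)) (I_pow (n + k))"
proof
  fix z assume z: "z \<in> ideal_colon R (x_plus r (n + h)) (I_pow n)"
  then have zc: "z \<in> carrier R" by (simp add: mem_ideal_colon_iff)
  have "z \<otimes> w \<in> x_plus r (n + k + h)" if "w \<in> I_pow (n + k)" for w
  proof (rule I_pow_prod_mem[OF x_plus_ideal zc _ that])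
    fix u v assume u: "u \<in> I_pow n" and v: "v \<in> I_pow k"
    have "z \<otimes> u \<in> x_plus r (n + h)" using z u by (simp add: mem_ideal_colon_iff)
    then have "z \<otimes> u \<otimes> v \<in> x_plus r (n + h + k)" using v by (rule x_plus_mult_I_pow)
    then show "z \<otimes> (u \<otimes> v) \<in> x_plus r (n + k + h)"
      using zc I_pow_carrier[OF u] I_pow_carrier[OF v] by (simp add: m_assoc add_ac)
  qed
  then show "z \<in> ideal_colon R (x_plus r (n + k + h)) (I_pow (n + k))"
    using zc by (simp add: mem_ideal_colon_iff)
qed

lemma divisible_sections_ideal: "ideal (divisible_sections h r) R"
proof -
  let ?C = "\<lambda>n. ideal_colon R (x_plus r (n + h)) (I_pow n)"
  have C: "ideal (?C n) R" for n
    using I_pow_carrier by (intro ideal_colon_ideal x_plus_ideal) blast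
  have mono: "?C n \<subseteq> ?C (max n n')" "?C n' \<subseteq> ?C (max n n')" for n n'
    using colon_chain_mono[of r n h "max n n' - n"] colon_chain_mono[of r n' h "max n n' - n'"] by simp_all
  show ?thesis
  proof (rule idealI_cring)
    show "divisible_sections h r \<subseteq> carrier R" using divisible_sections_carrier by blast
    show "\<zero> \<in> divisible_sections h r"
      unfolding divisible_sections_def using ideal_zero[OF C] by blast
    show "a \<oplus> b \<in> divisible_sections h r"
      if ab: "a \<in> divisible_sections h r" "b \<in> divisible_sections h r" for a b
    proof -
      obtain n n' where "a \<in> ?C n" "b \<in> ?C n'" using ab unfolding divisible_sections_def by blast
      then have "a \<in> ?C (max n n')" "b \<in> ?C (max n n')"
        using subsetD[OF mono(1)[of n n']] subsetD[OF mono(2)[of n' n]] by simp_all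
      then have "a \<oplus> b \<in> ?C (max n n')" by (rule ideal_add[OF C])
      then show ?thesis unfolding divisible_sections_def by blast
    qed
    show "t \<otimes> a \<in> divisible_sections h r" if "a \<in> divisible_sections h r" "t \<in> carrier R" for a t
      using that ideal_lmult[OF C] unfolding divisible_sections_def by blast
  qed
qed

text \<open>Elements of I^(m+n) are sums of products u v, and each factor can be spent on one of
  \<open>a\<close> and \<open>b\<close>; the mixed terms remain multiples of x^r.\<close>

lemma divisible_sections_mult:
  assumes "a \<in> divisible_sections h r" "b \<in> divisible_sections k r"
  shows "a \<otimes> b \<in> divisible_sections (h + k) r"
proof -
  have c: "a \<in> carrier R" "b \<in> carrier R" using assms divisible_sections_carrier by blast+
  obtain m where m: "\<And>w. w \<in> I_pow m \<Longrightarrow> a \<otimes> w \<in> x_plus r (m + h)"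
    using assms(1) by (rule divisible_sectionsE) blast
  obtain n where n: "\<And>w. w \<in> I_pow n \<Longrightarrow> b \<otimes> w \<in> x_plus r (n + k)"
    using assms(2) by (rule divisible_sectionsE) blast
  show ?thesis
  proof (rule divisible_sectionsI[of _ "m + n"])
    show "a \<otimes> b \<in> carrier R" using c by simp
    show "a \<otimes> b \<otimes> w \<in> x_plus r (m + n + (h + k))" if "w \<in> I_pow (m + n)" for w
    proof (rule I_pow_prod_mem[OF x_plus_ideal _ _ that])
      fix u v assume u: "u \<in> I_pow m" and v: "v \<in> I_pow n"
      have "(a \<otimes> u) \<otimes> (b \<otimes> v) \<in> x_plus r ((m + h) + (n + k))"
        by (rule x_plus_mult[OF m[OF u] n[OF v]])
      moreover have "(a \<otimes> u) \<otimes> (b \<otimes> v) = a \<otimes> b \<otimes> (u \<otimes> v)"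
        using c I_pow_carrier[OF u] I_pow_carrier[OF v] by (simp add: m_ac)
      ultimately show "a \<otimes> b \<otimes> (u \<otimes> v) \<in> x_plus r (m + n + (h + k))" by (simp add: add_ac)
    qed (use c in simp)
  qed
qed

lemma divisible_sections_pow:
  assumes "a \<in> divisible_sections h r"
  shows "a [^] (j::nat) \<in> divisible_sections (j * h) r"
proof (induct j)
  case 0
  then show ?case using I_pow_divisible_sections[of 0 r] by auto
next
  case (Suc j)
  then show ?case using divisible_sections_mult[OF Suc assms] by (simp add: nat_pow_Suc add.commute)
qed

text \<open>The colon bound modulo \<open>x\<close> splits off one factor \<open>x\<close>;
  cancelling \<open>x\<close> in the defining relation for \<open>z\<close> shows that the quotient
  \<open>z'\<close> is still divisible by x^r.\<close>

lemma divisible_sections_peel: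
  assumes h0: "stable_from h0" "h0 \<le> h" and z: "z \<in> divisible_sections (Suc h) (Suc r)"
  shows "\<exists>z'\<in>divisible_sections h r. \<exists>i\<in>I_pow (Suc h). z = x \<otimes> z' \<oplus> i"
proof -
  have zc: "z \<in> carrier R" using divisible_sections_carrier[OF z] .
  obtain n where n: "\<And>w. w \<in> I_pow n \<Longrightarrow> z \<otimes> w \<in> x_plus (Suc r) (n + Suc h)"
    using z by (rule divisible_sectionsE) blast
  have "x_plus (Suc r) (n + Suc h) \<subseteq> x_plus (Suc 0) (n + Suc h)" by (rule x_plus_antimono) auto
  then have "z \<in> ideal_colon R (x_plus (Suc 0) (n + Suc h)) (I_pow n)"
    using n zc unfolding mem_ideal_colon_iff by blast
  moreover have "Suc h \<ge> h0" using h0(2) by simp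
  ultimately have "z \<in> x_plus (Suc 0) (Suc h)" using h0(1) unfolding stable_from_def by blast
  then obtain z' i where z': "z' \<in> carrier R" "i \<in> I_pow (Suc h)" "z = x \<otimes> z' \<oplus> i"
    unfolding mem_x_plus_1 by blast
  have ic: "i \<in> carrier R" using I_pow_carrier[OF z'(2)] .
  have "z' \<in> divisible_sections h r"
  proof (rule divisible_sectionsI[OF z'(1), of n])
    fix w assume w: "w \<in> I_pow n"
    have wc: "w \<in> carrier R" using I_pow_carrier[OF w] .
    obtain b j where b: "b \<in> carrier R" "j \<in> I_pow (n + Suc h)" "z \<otimes> w = x [^] Suc r \<otimes> b \<oplus> j"
      using n[OF w] unfolding mem_x_plus by blast
    have jc: "j \<in> carrier R" using I_pow_carrier[OF b(2)] .
    define y where "y = x [^] r"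
    have yc: "y \<in> carrier R" by (simp add: y_def)
    have xr: "x [^] Suc r = x \<otimes> y" unfolding y_def by (simp add: nat_pow_Suc m_comm)
    have "x \<otimes> (z' \<otimes> w \<ominus> y \<otimes> b) = (x \<otimes> z' \<oplus> i) \<otimes> w \<ominus> x \<otimes> y \<otimes> b \<ominus> i \<otimes> w"
      using z'(1) ic wc b(1) yc x_carrier by algebra
    also have "\<dots> = (x \<otimes> y \<otimes> b \<oplus> j) \<ominus> x \<otimes> y \<otimes> b \<ominus> i \<otimes> w"
      using b(3) unfolding z'(3)[symmetric] xr by simp
    also have "\<dots> = j \<ominus> i \<otimes> w" using b(1) yc jc ic wc x_carrier by algebra
    also have "\<dots> \<in> I_pow (n + Suc h)"
    proof (rule ideal_minus[OF I_pow_ideal b(2)])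
      show "i \<otimes> w \<in> I_pow (n + Suc h)" using I_pow_mult[OF z'(2) w] by (simp add: add.commute)
    qed
    finally have "x \<otimes> (z' \<otimes> w \<ominus> y \<otimes> b) \<in> I_pow (Suc (n + h))" by simp
    moreover have "z' \<otimes> w \<ominus> y \<otimes> b \<in> carrier R" "n + h \<ge> h0" using z'(1) wc yc b(1) h0(2) by simp_all
    ultimately have "z' \<otimes> w \<ominus> y \<otimes> b \<in> I_pow (n + h)" using h0(1) unfolding stable_from_def by blast
    moreover have "z' \<otimes> w = y \<otimes> b \<oplus> (z' \<otimes> w \<ominus> y \<otimes> b)" using z'(1) wc yc b(1) by algebra
    ultimately show "z' \<otimes> w \<in> x_plus r (n + h)" using x_plusI[OF b(1)] unfolding y_def by metis
  qed
  then show ?thesis using z' by blast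
qed

text \<open>Peel off \<open>r\<close> factors of \<open>x\<close>. Each lowers \<open>h\<close> by
  one, so \<open>h\<close> has to start at least \<open>r\<close> above the threshold.\<close>

lemma divisible_sections_subset_x_plus:
  assumes h0: "stable_from h0" and "r + h0 \<le> h"
  shows "divisible_sections h r \<subseteq> x_plus r h"
  using assms(2)
proof (induct r arbitrary: h)
  case 0
  have "z \<in> x_plus 0 h" if "z \<in> carrier R" for z
    using x_plusI[OF that ideal_zero[OF I_pow_ideal], of 0] that by simp
  then show ?case using divisible_sections_carrier by blast
next
  case (Suc r)
  then obtain h' where h': "h = Suc h'" "r + h0 \<le> h'" by (cases h) auto
  show ?case
  proof
    fix z assume "z \<in> divisible_sections h (Suc r)"
    then obtain z' i where z': "z' \<in> divisible_sections h' r" "i \<in> I_pow (Suc h')" "z = x \<otimes> z' \<oplus> i"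
      using divisible_sections_peel[OF h0, of h' z r] h' by auto
    then have "z' \<in> x_plus r h'" using Suc(1)[OF h'(2)] by blast
    then obtain b j where b: "b \<in> carrier R" "j \<in> I_pow h'" "z' = x [^] r \<otimes> b \<oplus> j"
      unfolding mem_x_plus by blast
    have "z = x [^] Suc r \<otimes> b \<oplus> (x \<otimes> j \<oplus> i)"
      unfolding z'(3) b(3) using b(1) I_pow_carrier[OF b(2)] I_pow_carrier[OF z'(2)]
      by (simp add: nat_pow_Suc r_distr m_ac a_ac)
    moreover have "x \<otimes> j \<oplus> i \<in> I_pow h"
      unfolding h'(1) using ideal_add[OF I_pow_ideal x_mult[OF b(2)] z'(2)] .
    ultimately show "z \<in> x_plus (Suc r) h" using x_plusI[OF b(1)] by metis
  qed
qed

lemma x_plus_subset_I_pow: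
  assumes "k \<le> r" "k \<le> n"
  shows "x_plus r n \<subseteq> I_pow k"
proof (rule set_add_least[OF I_pow_ideal])
  show "PIdl (x [^] r) \<subseteq> I_pow k"
    using cgenideal_subset_iff[OF I_pow_ideal, of "x [^] r"] I_pow_antimonoD[OF x_pow_mem assms(1)] by simp
  show "I_pow n \<subseteq> I_pow k" using I_pow_antimonoD[OF _ assms(2)] by blast
qed

lemma infinitely_divisible_sections:
  assumes closed: "integrally_closed_ideal R (I_pow h)" and z: "\<And>r. z \<in> divisible_sections h r"
  shows "z \<in> I_pow h"
proof -
  obtain h0 where h0: "stable_from h0" using exists_stable_from by blast
  \<comment> \<open>A common denominator: z^j falls short of I^(jh) by at most \<open>h0\<close>,
    whatever \<open>j\<close> is.\<close>
  obtain y where y: "y \<in> I_pow h0" "nonzerodivisor y" using grade_ge_2 by blast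
  have zc: "z \<in> carrier R" using z divisible_sections_carrier by blast
  have pow: "z [^] j \<in> I_pow (j * h - h0)" for j
  proof (cases "h0 \<le> j * h")
    case True
    have "z [^] j \<in> divisible_sections (j * h) (j * h - h0)" by (rule divisible_sections_pow[OF z])
    then have "z [^] j \<in> x_plus (j * h - h0) (j * h)"
      using divisible_sections_subset_x_plus[OF h0, of "j * h - h0" "j * h"] True by auto
    then show ?thesis using x_plus_subset_I_pow[of "j * h - h0" "j * h - h0" "j * h"] by auto
  next
    case False
    \<comment> \<open>The truncated exponent is 0, and I^0 is the whole ring.\<close>
    then show ?thesis using zc by simp
  qed
  have "y \<otimes> z [^] j \<in> ideal_pow R (I_pow h) j" for j
  proof -
    have "y \<otimes> z [^] j \<in> I_pow (h0 + (j * h - h0))" using I_pow_mult[OF y(1) pow] .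
    then have "y \<otimes> z [^] j \<in> I_pow (h * j)" by (rule I_pow_antimonoD) (simp add: mult.commute)
    then show ?thesis by (simp only: ideal_pow_pow[OF I.is_ideal])
  qed
  then have "z \<in> ideal_integral_closure R (I_pow h)"
    using integral_of_bounded_denominator[OF _ zc I_pow_ideal y(2)] y(2) by (simp add: nonzerodivisor_def)
  then show ?thesis using closed by (simp add: integrally_closed_ideal_def)
qed

text \<open>The ideals descend in \<open>r\<close> and contain I^h, so they stabilise by the
  Artinian property of A/I^h; elements of the stable value are divisible for every
  \<open>r\<close>.\<close>

lemma divisible_sections_eventually:
  assumes closed: "integrally_closed_ideal R (I_pow h)"
    and \<mm>: "maximalideal \<mm> R" "\<And>t. t \<in> \<mm> \<Longrightarrow> \<exists>n::nat. t [^] n \<in> I"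
  shows "\<exists>r0. \<forall>r\<ge>r0. divisible_sections h r \<subseteq> I_pow h"
proof -
  have nil: "\<exists>n::nat. t [^] n \<in> I_pow h" if t: "t \<in> \<mm>" for t
  proof -
    have tc: "t \<in> carrier R" using t ideal.Icarr[OF maximalideal.axioms(1)[OF \<mm>(1)]] by blast
    obtain n :: nat where "t [^] n \<in> I_pow (Suc 0)" using \<mm>(2)[OF t] unfolding mem_I_pow_1 by blast
    from ideal_pow_elem_pow[OF I.is_ideal this, of h] have "t [^] (n * h) \<in> I_pow h"
      using tc by (simp add: nat_pow_pow)
    then show ?thesis by blast
  qed
  have "\<exists>r0. \<forall>r\<ge>r0. divisible_sections h r = divisible_sections h r0"
    using descending_chain_stable[OF \<mm>(1) I_pow_ideal nil divisible_sections_ideal I_pow_divisible_sections]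
      divisible_sections_antimono by simp
  then obtain r0 where r0: "\<And>r. r \<ge> r0 \<Longrightarrow> divisible_sections h r = divisible_sections h r0" by blast
  have "z \<in> I_pow h" if z: "z \<in> divisible_sections h r0" for z
  proof (rule infinitely_divisible_sections[OF closed])
    fix r show "z \<in> divisible_sections h r"
    proof (cases "r0 \<le> r")
      case True
      then show ?thesis using z r0 by blast
    next
      case False
      then show ?thesis using z divisible_sections_antimono[of r r0] by auto
    qed
  qed
  then show ?thesis using r0 by blast
qed

text \<open>Peeling lowers both indices by one, so a single inclusion propagates along the
  diagonal.\<close>

lemma divisible_sections_shift:
  assumes h0: "stable_from h0" "h0 \<le> h" and base: "divisible_sections h r \<subseteq> I_pow h"
  shows "divisible_sections (h + k) (r + k) \<subseteq> I_pow (h + k)"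
proof (induct k)
  case 0
  then show ?case using base by simp
next
  case (Suc k)
  show ?case
  proof
    fix z assume "z \<in> divisible_sections (h + Suc k) (r + Suc k)"
    then obtain z' i where z': "z' \<in> divisible_sections (h + k) (r + k)" "i \<in> I_pow (Suc (h + k))"
      "z = x \<otimes> z' \<oplus> i"
      using divisible_sections_peel[OF h0(1), of "h + k" z "r + k"] h0(2) by auto
    then have "z' \<in> I_pow (h + k)" using Suc by blast
    then show "z \<in> I_pow (h + Suc k)"
      unfolding z'(3) using ideal_add[OF I_pow_ideal x_mult z'(2)] by simp
  qed
qed

end

section \<open>Bounding the powers\<close>

context cring
begin

lemma cgenideal_prod_eq:
  assumes "a \<in> carrier R" "b \<in> carrier R"
  shows "(PIdl a) \<cdot> (PIdl b) = PIdl (a \<otimes> b)"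
proof -
  have "(PIdl a) \<cdot> (PIdl b) = {b \<otimes> t |t. t \<in> PIdl a}"
    by (rule ideal_prod_cgenideal[OF cgenideal_ideal[OF assms(1)] assms(2)])
  also have "\<dots> = {b \<otimes> (a \<otimes> r) |r. r \<in> carrier R}"
    using mem_cgenideal_iff[OF assms(1)] by auto
  also have "\<dots> = {a \<otimes> b \<otimes> r |r. r \<in> carrier R}"
    using assms by (intro Collect_cong ex_cong1) (auto simp: m_ac)
  also have "\<dots> = PIdl (a \<otimes> b)"
    using mem_cgenideal_iff[of "a \<otimes> b"] assms by auto
  finally show ?thesis .
qed

lemma ideal_pow_cgenideal:
  assumes "a \<in> carrier R"
  shows "ideal_pow R (PIdl a) n = PIdl (a [^] n)"
proof (induct n)
  case 0
  then show ?case using cgenideal_eq_genideal[OF one_closed] genideal_one by simp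
next
  case (Suc n)
  then show ?case unfolding ideal_pow_Suc using cgenideal_prod_eq[of "a [^] n" a] assms by simp
qed

lemma ideal_pow_distrib:
  assumes "ideal J R" "ideal K R"
  shows "ideal_pow R (J \<cdot> K) n = ideal_pow R J n \<cdot> ideal_pow R K n"
proof -
  interpret S: comm_monoid "ideals_set R" by (rule ideals_set_is_comm_monoid)
  from S.nat_pow_distrib[of J K n] show ?thesis using assms by (simp add: ideals_set_def)
qed

lemma ideal_prod_left_comm:
  assumes "ideal J R" "ideal K R" "ideal L R"
  shows "J \<cdot> (K \<cdot> L) = K \<cdot> (J \<cdot> L)"
  using assms by (metis ideal_prod_assoc ideal_prod_commute)

text \<open>Replaces the factor \<open>Z\<close> by \<open>Y\<close>. In the error term
  \<open>V\<close> stands in front of B L, a product with one factor fewer, to which an inductive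
  bound can be applied.\<close>

lemma ideal_prod_exchange:
  assumes "ideal B R" "ideal L R" "ideal Y R" "ideal V R" and "Z \<subseteq> Y <+> V"
  shows "B \<cdot> (Z \<cdot> L) \<subseteq> B \<cdot> (Y \<cdot> L) <+> V \<cdot> (B \<cdot> L)"
proof -
  have "B \<cdot> (Z \<cdot> L) \<subseteq> B \<cdot> ((Y <+> V) \<cdot> L)"
    by (intro ideal_prod_mono order_refl assms(5))
  also have "(Y <+> V) \<cdot> L = Y \<cdot> L <+> V \<cdot> L"
    by (rule ideal_prod_distr(2)[OF assms(2-4)])
  also have "B \<cdot> (Y \<cdot> L <+> V \<cdot> L) = B \<cdot> (Y \<cdot> L) <+> B \<cdot> (V \<cdot> L)"
    by (intro ideal_prod_r_distr ideal_prod_is_ideal assms)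
  also have "B \<cdot> (V \<cdot> L) = V \<cdot> (B \<cdot> L)"
    by (rule ideal_prod_left_comm[OF assms(1,4,2)])
  finally show ?thesis .
qed

text \<open>
  The error terms in expanding \<open>P\<^sup>j \<subseteq> (C + V)\<^sup>j\<close> have the order of a mixed product \<open>C\<^sup>i P\<^sup>l\<close> with
  \<open>i + l < j\<close>, which in turn is controlled by trading \<open>C\<close> back for \<open>P\<close>.
\<close>

lemma ideal_pow_exchange:
  fixes m j d :: nat
  assumes J: "ideal J R" and P: "ideal P R" and C: "ideal C R"
    and PC: "P \<subseteq> C <+> ideal_pow R J (Suc m)" and CP: "C \<subseteq> P <+> ideal_pow R J (Suc m)"
    and bound: "\<And>l. l < j \<Longrightarrow> ideal_pow R P l \<subseteq> ideal_pow R J (m * l + (l - d))" and "d < j"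
  shows "ideal_pow R P j \<subseteq> ideal_pow R C j <+> ideal_pow R J (m * j + (j - d))"
proof -
  let ?V = "ideal_pow R J (Suc m)"
  let ?e = "m * j + (j - d)"
  note ids = ideal_pow_ideal[OF J] ideal_pow_ideal[OF P] ideal_pow_ideal[OF C]
  \<comment> \<open>Trade the factors \<open>C\<close> for \<open>P\<close> one at a time until
    \<open>bound\<close> applies; every error has \<open>?V\<close> in place of one factor.\<close>
  have mixed: "ideal_pow R C i \<cdot> ideal_pow R P l \<subseteq> ideal_pow R J (m * (i + l) + (i + l - d))"
    if "i + l < j" for i l
    using that
  proof (induct i arbitrary: l)
    case 0
    have "carrier R \<cdot> ideal_pow R P l = ideal_pow R P l"
      using ideal_prod_commute[OF oneideal ids(2)] ideal_prod_one[OF ids(2)] by simp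
    then show ?case using bound[of l] 0 by simp
  next
    case (Suc i)
    let ?Ci = "ideal_pow R C i" and ?Pl = "ideal_pow R P l"
    have "ideal_pow R C (Suc i) \<cdot> ?Pl = ?Ci \<cdot> (C \<cdot> ?Pl)"
      unfolding ideal_pow_Suc by (rule ideal_prod_assoc[OF ids(3) C ids(2)])
    also have "\<dots> \<subseteq> ?Ci \<cdot> (P \<cdot> ?Pl) <+> ?V \<cdot> (?Ci \<cdot> ?Pl)"
      by (rule ideal_prod_exchange[OF ids(3) ids(2) P ids(1) CP])
    also have "\<dots> \<subseteq> ideal_pow R J (m * (Suc i + l) + (Suc i + l - d))"
    proof (rule set_add_least[OF ids(1)])
      have "?Ci \<cdot> (P \<cdot> ?Pl) = ?Ci \<cdot> ideal_pow R P (Suc l)" by (simp only: ideal_pow_Suc2[OF P])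
      then show "?Ci \<cdot> (P \<cdot> ?Pl) \<subseteq> ideal_pow R J (m * (Suc i + l) + (Suc i + l - d))"
        using Suc(1)[of "Suc l"] Suc(2) by simp
      have "?V \<cdot> (?Ci \<cdot> ?Pl) \<subseteq> ?V \<cdot> ideal_pow R J (m * (i + l) + (i + l - d))"
        using Suc by (intro ideal_prod_mono) auto
      also have "\<dots> = ideal_pow R J (Suc m + (m * (i + l) + (i + l - d)))"
        by (simp only: ideal_pow_add[OF J])
      also have "\<dots> \<subseteq> ideal_pow R J (m * (Suc i + l) + (Suc i + l - d))"
      proof (rule ideal_pow_antimono[OF J])
        \<comment> \<open>Losing a factor costs \<open>m\<close> and at most one more; the order m +
          1 of \<open>?V\<close> pays for both.\<close>
        have "m * (Suc i + l) = m + m * (i + l)" "Suc i + l - d \<le> Suc (i + l - d)" by simp_all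
        then show "m * (Suc i + l) + (Suc i + l - d) \<le> Suc m + (m * (i + l) + (i + l - d))" by linarith
      qed
      finally show "?V \<cdot> (?Ci \<cdot> ?Pl) \<subseteq> ideal_pow R J (m * (Suc i + l) + (Suc i + l - d))" .
    qed
    finally show ?case .
  qed
  \<comment> \<open>The opposite trade, from \<open>P\<close> to \<open>C\<close>, with all errors
    collected at order \<open>?e\<close>.\<close>
  have "ideal_pow R P j \<subseteq> ideal_pow R C i \<cdot> ideal_pow R P (j - i) <+> ideal_pow R J ?e" if "i \<le> j" for i
    using that
  proof (induct i)
    case 0
    have "carrier R \<cdot> ideal_pow R P j = ideal_pow R P j"
      using ideal_prod_commute[OF oneideal ids(2)] ideal_prod_one[OF ids(2)] by simp
    then show ?case using set_add_upper(1)[OF ids(2) ids(1)] by simp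
  next
    case (Suc i)
    define l where "l = j - Suc i"
    have l: "j - i = Suc l" "i + l < j" "i + l = j - 1" using Suc(2) by (simp_all add: l_def)
    let ?Ci = "ideal_pow R C i" and ?Pl = "ideal_pow R P l"
    let ?S = "ideal_pow R C (Suc i) \<cdot> ?Pl <+> ideal_pow R J ?e"
    have S: "ideal ?S R" by (intro add_ideals ideal_prod_is_ideal ids)
    have up: "ideal_pow R C (Suc i) \<cdot> ?Pl \<subseteq> ?S" "ideal_pow R J ?e \<subseteq> ?S"
      by (intro set_add_upper ideal_prod_is_ideal ids)+
    have "?Ci \<cdot> ideal_pow R P (Suc l) = ?Ci \<cdot> (P \<cdot> ?Pl)" by (simp only: ideal_pow_Suc2[OF P])
    also have "\<dots> \<subseteq> ?Ci \<cdot> (C \<cdot> ?Pl) <+> ?V \<cdot> (?Ci \<cdot> ?Pl)"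
      by (rule ideal_prod_exchange[OF ids(3) ids(2) C ids(1) PC])
    also have "\<dots> \<subseteq> ?S"
    proof (rule set_add_least[OF S])
      have "?Ci \<cdot> (C \<cdot> ?Pl) = ideal_pow R C (Suc i) \<cdot> ?Pl"
        unfolding ideal_pow_Suc by (rule ideal_prod_assoc[OF ids(3) C ids(2), symmetric])
      then show "?Ci \<cdot> (C \<cdot> ?Pl) \<subseteq> ?S" using up(1) by simp
      have "?V \<cdot> (?Ci \<cdot> ?Pl) \<subseteq> ?V \<cdot> ideal_pow R J (m * (i + l) + (i + l - d))"
        using mixed[OF l(2)] by (intro ideal_prod_mono) auto
      also have "\<dots> = ideal_pow R J (Suc m + (m * (i + l) + (i + l - d)))"
        by (simp only: ideal_pow_add[OF J])
      also have "\<dots> \<subseteq> ideal_pow R J ?e"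
      proof (rule ideal_pow_antimono[OF J])
        \<comment> \<open>As d < j, the subtraction in j - 1 - d is not truncated, and m + 1 + m (j
          - 1) + (j - 1 - d) is exactly \<open>?e\<close>.\<close>
        have j: "j = Suc (i + l)" using l by simp
        show "?e \<le> Suc m + (m * (i + l) + (i + l - d))"
          using \<open>d < j\<close> unfolding j by (simp add: algebra_simps)
      qed
      finally show "?V \<cdot> (?Ci \<cdot> ?Pl) \<subseteq> ?S" using up(2) by blast
    qed
    finally have "?Ci \<cdot> ideal_pow R P (j - i) \<subseteq> ?S" unfolding l(1) .
    then have "?Ci \<cdot> ideal_pow R P (j - i) <+> ideal_pow R J ?e \<subseteq> ?S"
      using up(2) by (rule set_add_least[OF S])
    then show ?case using Suc unfolding l_def by auto
  qed
  from this[of j] show ?thesis using ideal_prod_one[OF ids(3)] by simp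
qed

end

section \<open>Powers of an element that is divisible by \<open>x\<close> once\<close>

context superficial_element
begin

text \<open>The expansion of (a u)^j in terms of ideals: \<open>P\<close> is a I^m, the ideal
  \<open>C\<close> contains the multiples of \<open>x\<close> that approximate it, and C^j lies in
  (x^j).\<close>

lemma power_bound_step:
  assumes a: "a \<in> carrier R" and m: "\<And>w. w \<in> I_pow m \<Longrightarrow> a \<otimes> w \<in> x_plus (Suc 0) (Suc m)"
    and bound: "\<And>l. l < j \<Longrightarrow> a [^] l \<in> I_pow (l - d)" and dj: "d < j"
  shows "a [^] j \<in> divisible_sections (j - d) j"
proof -
  define P where "P = I_pow m \<cdot> (PIdl a)"
  define V where "V = I_pow (Suc m)"
  \<comment> \<open>Intersecting with P + V rather than taking all of (x) lets \<open>C\<close> be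
    traded back for \<open>P\<close> modulo \<open>V\<close>.\<close>
  define C where "C = (P <+> V) \<inter> PIdl x"
  have Pa: "ideal (PIdl a) R" and Px: "ideal (PIdl x) R" using a by (simp_all add: cgenideal_ideal)
  have P: "ideal P R" unfolding P_def by (rule ideal_prod_is_ideal[OF I_pow_ideal Pa])
  have V: "ideal V R" unfolding V_def by (rule I_pow_ideal)
  have C: "ideal C R" unfolding C_def by (intro i_intersect add_ideals P V Px)
  have P_pow: "ideal_pow R P l = I_pow (m * l) \<cdot> (PIdl (a [^] l))" for l
    unfolding P_def ideal_pow_distrib[OF I_pow_ideal Pa] ideal_pow_cgenideal[OF a]
      ideal_pow_pow[OF I.is_ideal] ..
  have "P \<subseteq> C <+> V"
  proof
    fix p assume p: "p \<in> P"
    then obtain w where w: "w \<in> I_pow m" "p = a \<otimes> w"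
      unfolding P_def ideal_prod_cgenideal[OF I_pow_ideal a] by blast
    then obtain b i where b: "b \<in> carrier R" "i \<in> V" "p = x \<otimes> b \<oplus> i"
      using m unfolding mem_x_plus_1 V_def by blast
    have ic: "i \<in> carrier R" using b(2) ideal.Icarr[OF V] by blast
    have pc: "p \<in> carrier R" using p ideal.Icarr[OF P] by blast
    have "x \<otimes> b = p \<oplus> (\<ominus> i)" unfolding b(3) using b(1) ic x_carrier by algebra
    then have "x \<otimes> b \<in> P <+> V" using set_addI[OF p ideal_uminus[OF V b(2)]] by simp
    moreover have "x \<otimes> b \<in> PIdl x" using b(1) mem_cgenideal_iff[OF x_carrier] by blast
    ultimately have "x \<otimes> b \<in> C" unfolding C_def by blast
    then show "p \<in> C <+> V" unfolding b(3) using b(2) by (rule set_addI)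
  qed
  moreover have "C \<subseteq> P <+> V" by (simp add: C_def)
  moreover have "ideal_pow R P l \<subseteq> I_pow (m * l + (l - d))" if "l < j" for l
  proof -
    have "PIdl (a [^] l) \<subseteq> I_pow (l - d)"
      using bound[OF that] cgenideal_subset_iff[OF I_pow_ideal, of "a [^] l"] a by simp
    then show ?thesis
      unfolding P_pow ideal_pow_add[OF I.is_ideal] by (intro ideal_prod_mono order_refl)
  qed
  ultimately have "ideal_pow R P j \<subseteq> ideal_pow R C j <+> I_pow (m * j + (j - d))"
    using ideal_pow_exchange[OF I.is_ideal P C _ _ _ dj, of m] unfolding V_def by blast
  also have "\<dots> \<subseteq> x_plus j (m * j + (j - d))"
  proof (rule set_add_mono[OF _ order_refl])
    show "ideal_pow R C j \<subseteq> PIdl (x [^] j)"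
      using ideal_pow_base_mono[of C "PIdl x" j] ideal_pow_cgenideal[OF x_carrier] by (simp add: C_def)
  qed
  finally have sub: "I_pow (m * j) \<cdot> (PIdl (a [^] j)) \<subseteq> x_plus j (m * j + (j - d))" unfolding P_pow .
  show ?thesis
  proof (rule divisible_sectionsI[of _ "m * j"])
    show "a [^] j \<in> carrier R" using a by simp
    show "a [^] j \<otimes> w \<in> x_plus j (m * j + (j - d))" if "w \<in> I_pow (m * j)" for w
      using sub that unfolding ideal_prod_cgenideal[OF I_pow_ideal, of "a [^] j", OF nat_pow_closed[OF a]]
      by blast
  qed
qed

lemma power_bound:
  assumes a: "a \<in> divisible_sections (Suc 0) (Suc 0)"
    and closed: "\<And>n. n \<ge> N \<Longrightarrow> integrally_closed_ideal R (I_pow n)"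
    and \<mm>: "maximalideal \<mm> R" "\<And>t. t \<in> \<mm> \<Longrightarrow> \<exists>n::nat. t [^] n \<in> I"
  shows "\<exists>d. \<forall>j. a [^] j \<in> I_pow (j - d)"
proof -
  have ac: "a \<in> carrier R" using divisible_sections_carrier[OF a] .
  obtain m where m: "\<And>w. w \<in> I_pow m \<Longrightarrow> a \<otimes> w \<in> x_plus (Suc 0) (m + Suc 0)"
    using a by (rule divisible_sectionsE) blast
  obtain h0 where h0: "stable_from h0" using exists_stable_from by blast
  define h where "h = max h0 N"
  have h: "h0 \<le> h" "N \<le> h" by (simp_all add: h_def)
  obtain r0 where r0: "\<And>r. r \<ge> r0 \<Longrightarrow> divisible_sections h r \<subseteq> I_pow h"
    using divisible_sections_eventually[OF closed[OF h(2)] \<mm>] by blast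
  \<comment> \<open>At this exponent the divisibility index passes the threshold for r = 1, so a
    power of \<open>a\<close> lies in (x) + I^(h0+1) and hence in \<open>I\<close>; this covers the
    initial exponents of the induction.\<close>
  have "a [^] Suc h0 \<in> divisible_sections (Suc h0) (Suc 0)" using divisible_sections_pow[OF a, of "Suc h0"] by simp
  then have "a [^] Suc h0 \<in> x_plus (Suc 0) (Suc h0)"
    using divisible_sections_subset_x_plus[OF h0, of "Suc 0" "Suc h0"] by auto
  then have "a [^] Suc h0 \<in> I_pow (Suc 0)" using x_plus_subset_I_pow[of "Suc 0" "Suc 0" "Suc h0"] by auto
  from ideal_pow_elem_pow[OF I.is_ideal this, of h] have aL: "a [^] (Suc h0 * h) \<in> I_pow h"
    using ac by (simp only: nat_pow_pow mult_Suc mult_0 add_0_right)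
  define L where "L = Suc h0 * h"
  have aL': "a [^] l \<in> I_pow h" if "L \<le> l" for l
  proof -
    have "a [^] l = a [^] L \<otimes> a [^] (l - L)" using nat_pow_mult[OF ac, of L "l - L"] that by simp
    then show ?thesis using ideal_rmult[OF I_pow_ideal aL] ac by (simp add: L_def)
  qed
  \<comment> \<open>At least \<open>L\<close>, so that for d < j \<le> d + h the membership of a^j
    in I^h is enough; at least \<open>r0\<close>, so that the diagonal shift can start at d +
    h.\<close>
  define d where "d = max r0 L"
  have "a [^] j \<in> I_pow (j - d)" for j
  proof (induct j rule: less_induct)
    case (less j)
    show ?case
    proof (cases "j \<le> d + h")
      case True
      show ?thesis
      proof (cases "j \<le> d")
        case True
        then show ?thesis using ac by simp
      next
        case False
        then have "a [^] j \<in> I_pow h" by (intro aL') (simp add: d_def)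
        then show ?thesis by (rule I_pow_antimonoD) (use \<open>j \<le> d + h\<close> in simp)
      qed
    next
      case False
      have "a [^] j \<in> divisible_sections (j - d) j"
        using power_bound_step[OF ac _ less, of m] m False by simp
      \<comment> \<open>The pair (j - d, j) lies on the diagonal through (h, d + h).\<close>
      moreover have "j - d = h + (j - d - h)" "j = (d + h) + (j - d - h)" using False by simp_all
      moreover have "divisible_sections h (d + h) \<subseteq> I_pow h" by (rule r0) (simp add: d_def)
      ultimately show ?thesis using divisible_sections_shift[OF h0 h(1), of "d + h" "j - d - h"] by auto
    qed
  qed
  then show ?thesis by blast
qed

text \<open>The witness in the Ratliff-Rush closure is \<open>N\<close> and not \<open>n\<close>:
  each product with an element of I^N is integral over I^(N+1), which is integrally closed.\<close>

theorem colon_mod_x_subset_closure: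
  assumes a: "a \<in> ideal_colon R (x_plus (Suc 0) (Suc n)) (I_pow n)"
    and closed: "\<And>n. n \<ge> N \<Longrightarrow> integrally_closed_ideal R (I_pow n)"
    and \<mm>: "maximalideal \<mm> R" "\<And>t. t \<in> \<mm> \<Longrightarrow> \<exists>n::nat. t [^] n \<in> I"
  shows "a \<in> ratliff_rush_closure R I"
proof -
  have ac: "a \<in> carrier R" using a by (simp add: mem_ideal_colon_iff)
  have "a \<in> divisible_sections (Suc 0) (Suc 0)"
    by (rule divisible_sectionsI[of _ n]) (use a in \<open>simp_all add: mem_ideal_colon_iff\<close>)
  then obtain d where d: "\<And>j. a [^] j \<in> I_pow (j - d)" using power_bound[OF _ closed \<mm>] by blast
  \<comment> \<open>\<open>y\<close> makes up for the deficit \<open>d\<close> in the orders of all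
    powers of \<open>a\<close> at once.\<close>
  obtain y where y: "y \<in> I_pow d" "nonzerodivisor y" using grade_ge_2 by blast
  have yc: "y \<in> carrier R" using y(2) by (simp add: nonzerodivisor_def)
  have "a \<otimes> w \<in> I_pow (Suc N)" if w: "w \<in> I_pow N" for w
  proof -
    have wc: "w \<in> carrier R" using I_pow_carrier[OF w] .
    have "y \<otimes> (a \<otimes> w) [^] j \<in> ideal_pow R (I_pow (Suc N)) j" for j
    proof -
      have "y \<otimes> (a [^] j \<otimes> w [^] j) \<in> I_pow (d + ((j - d) + N * j))"
        by (intro I_pow_mult y(1) d ideal_pow_elem_pow[OF I.is_ideal w])
      then have "y \<otimes> (a [^] j \<otimes> w [^] j) \<in> I_pow (Suc N * j)" by (rule I_pow_antimonoD) simp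
      then show ?thesis
        using ac wc by (simp only: ideal_pow_pow[OF I.is_ideal] nat_pow_distrib)
    qed
    then have "a \<otimes> w \<in> ideal_integral_closure R (I_pow (Suc N))"
      using integral_of_bounded_denominator[OF yc _ I_pow_ideal y(2), of "a \<otimes> w" "Suc N"] ac wc by simp
    then show ?thesis using closed[of "Suc N"] by (simp add: integrally_closed_ideal_def)
  qed
  then have "a \<in> ideal_colon R (I_pow (N + 1)) (I_pow N)" using ac by (simp add: mem_ideal_colon_iff)
  then show ?thesis unfolding ratliff_rush_closure_def by blast
qed

end

section \<open>Depth, superficial elements and quotients\<close>

context cring
begin

section \<open>Regular pairs from depth\<close>

lemma nonzerodivisor_pow:
  assumes "nonzerodivisor p"
  shows "nonzerodivisor (p [^] (n::nat))"
proof (induct n)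
  case 0
  then show ?case by (simp add: nonzerodivisor_def)
next
  case (Suc n)
  have pc: "p \<in> carrier R" using assms by (simp add: nonzerodivisor_def)
  have "z = \<zero>" if "z \<in> carrier R" "p [^] Suc n \<otimes> z = \<zero>" for z
  proof -
    have "p [^] n \<otimes> (p \<otimes> z) = \<zero>" using that pc by (simp add: m_assoc)
    then have "p \<otimes> z = \<zero>" using Suc that pc by (simp add: nonzerodivisor_def)
    then show ?thesis using assms that by (simp add: nonzerodivisor_def)
  qed
  then show ?case using pc by (simp add: nonzerodivisor_def)
qed

text \<open>First pass to powers of \<open>q\<close> with \<open>p\<close> fixed. For p^n, write
  \<open>a\<close> as p c, cancel the nonzerodivisor \<open>p\<close> and use induction on
  n.\<close>

lemma regular_pair_pow:
  assumes p: "nonzerodivisor p" and q: "q \<in> carrier R"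
    and reg: "\<And>a. a \<in> carrier R \<Longrightarrow> q \<otimes> a \<in> PIdl p \<Longrightarrow> a \<in> PIdl p"
    and a: "a \<in> carrier R" "q [^] (k::nat) \<otimes> a \<in> PIdl (p [^] (n::nat))"
  shows "a \<in> PIdl (p [^] n)"
proof -
  have pc: "p \<in> carrier R" using p by (simp add: nonzerodivisor_def)
  have reg': "a \<in> PIdl p" if "a \<in> carrier R" "q [^] k \<otimes> a \<in> PIdl p" for a and k :: nat
    using that
  proof (induct k arbitrary: a)
    case 0
    then show ?case by simp
  next
    case (Suc k)
    have "q [^] k \<otimes> (q \<otimes> a) \<in> PIdl p" using Suc(2,3) q by (simp add: m_assoc)
    then show ?case using Suc(1)[of "q \<otimes> a"] reg[OF Suc(2)] Suc(2) q by simp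
  qed
  have "a \<in> PIdl (p [^] n)" if "a \<in> carrier R" "q [^] k \<otimes> a \<in> PIdl (p [^] n)" for a
    using that
  proof (induct n arbitrary: a)
    case 0
    then show ?case using mem_cgenideal_iff[OF one_closed] by auto
  next
    case (Suc n)
    obtain b where b: "b \<in> carrier R" "q [^] k \<otimes> a = p [^] Suc n \<otimes> b"
      using Suc(3) mem_cgenideal_iff[of "p [^] Suc n"] pc by auto
    have eq: "p [^] Suc n \<otimes> b = p \<otimes> (p [^] n \<otimes> b)" using pc b(1) by (simp add: m_ac)
    have "q [^] k \<otimes> a \<in> PIdl p"
      unfolding mem_cgenideal_iff[OF pc] b(2) eq using b(1) pc by blast
    then have "a \<in> PIdl p" by (rule reg'[OF Suc(2)])
    then obtain c where c: "c \<in> carrier R" "a = p \<otimes> c" unfolding mem_cgenideal_iff[OF pc] by blast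
    have "p \<otimes> (q [^] k \<otimes> c) = p \<otimes> (p [^] n \<otimes> b)"
      using b(2) eq c pc q by (simp add: m_lcomm)
    then have "q [^] k \<otimes> c = p [^] n \<otimes> b"
      using nonzerodivisor_cancel[OF p] b(1) c(1) pc q by simp
    then have "q [^] k \<otimes> c \<in> PIdl (p [^] n)" using mem_cgenideal_iff[of "p [^] n"] b(1) pc by auto
    then have "c \<in> PIdl (p [^] n)" using Suc(1) c(1) by blast
    then obtain e where "e \<in> carrier R" "c = p [^] n \<otimes> e" using mem_cgenideal_iff[of "p [^] n"] pc by auto
    then have "a = p [^] Suc n \<otimes> e" "e \<in> carrier R" unfolding c(2) using pc by (simp_all add: m_ac)
    then show ?case using mem_cgenideal_iff[of "p [^] Suc n"] pc by auto
  qed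
  then show ?thesis using a by blast
qed

lemma regular_pair_of_depth:
  assumes "ring_depth R \<mm> \<ge> 2"
  shows "\<exists>p\<in>\<mm>. \<exists>q\<in>\<mm>. nonzerodivisor p \<and> q \<in> carrier R \<and>
    (\<forall>a\<in>carrier R. q \<otimes> a \<in> PIdl p \<longrightarrow> a \<in> PIdl p)"
proof -
  have "1 < ring_depth R \<mm>" using assms by (rule less_le_trans[rotated]) (simp add: one_enat_def numeral_eq_enat)
  then obtain xs where xs: "regular_sequence R xs" "set xs \<subseteq> \<mm>" "1 < enat (length xs)"
    unfolding ring_depth_def less_SUP_iff by blast
  then have len: "1 < length xs" by (simp add: one_enat_def)
  let ?p = "xs ! 0" and ?q = "xs ! 1"
  have pos: "0 < length xs" using len by linarith
  have mem: "?p \<in> set xs" "?q \<in> set xs" by (rule nth_mem[OF pos], rule nth_mem[OF len])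
  have c: "?p \<in> carrier R" "?q \<in> carrier R" using xs(1) mem by (auto simp: regular_sequence_def)
  have step: "a \<in> Idl (set (take i xs))"
    if "i < length xs" "a \<in> carrier R" "xs ! i \<otimes> a \<in> Idl (set (take i xs))" for i a
    using xs(1) that unfolding regular_sequence_def by blast
  have "Idl {} \<subseteq> {\<zero>}" by (rule genideal_minimal[OF zeroideal]) simp
  moreover have "\<zero> \<in> Idl {}" using genideal_ideal[of "{}"] ideal_zero by simp
  ultimately have Idl_empty: "Idl {} = {\<zero>}" by blast
  have "nonzerodivisor ?p"
    unfolding nonzerodivisor_def using step[OF pos] c(1) Idl_empty by simp
  moreover have "take 1 xs = [?p]" using len by (cases xs) auto
  then have "a \<in> PIdl ?p" if "a \<in> carrier R" "?q \<otimes> a \<in> PIdl ?p" for a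
    using step[OF len that(1)] that(2) cgenideal_eq_genideal[OF c(1)] by simp
  ultimately show ?thesis using mem xs(2) c by blast
qed

end

lemma (in noetherian_cring) exists_maximalideal_superset:
  assumes "ideal J R" "J \<noteq> carrier R"
  shows "\<exists>M. maximalideal M R \<and> J \<subseteq> M"
proof -
  let ?C = "{L. ideal L R \<and> L \<noteq> carrier R \<and> J \<subseteq> L}"
  have "\<exists>M\<in>?C. \<forall>L\<in>?C. M \<subseteq> L \<longrightarrow> L = M"
    by (rule maximal_ideal_in_family) (use assms in auto)
  then obtain M where "M \<in> ?C" and max': "\<forall>L\<in>?C. M \<subseteq> L \<longrightarrow> L = M" by (rule bexE)
  then have M: "ideal M R" "M \<noteq> carrier R" "J \<subseteq> M" by simp_all
  have max: "L = M" if "ideal L R" "L \<noteq> carrier R" "J \<subseteq> L" "M \<subseteq> L" for L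
    using that max' by simp
  have "maximalideal M R"
  proof (rule maximalidealI[OF M(1)])
    show "carrier R \<noteq> M" using M(2) by simp
    show "L = M \<or> L = carrier R" if "ideal L R" "M \<subseteq> L" for L
      using max[OF that(1) _ _ that(2)] M(3) that(2) by blast
  qed
  then show ?thesis using M(3) by blast
qed

sublocale noetherian_local_ring \<subseteq> noetherian_cring R
  by unfold_locales

section \<open>Krull intersection and superficial elements in the local ring\<close>

context noetherian_local_ring
begin

lemma unit_of_not_mem_maximal:
  assumes "u \<in> carrier R" "u \<notin> M"
  shows "\<exists>v\<in>carrier R. u \<otimes> v = \<one>"
proof -
  have "PIdl u = carrier R"
  proof (rule ccontr)
    assume "PIdl u \<noteq> carrier R"
    then obtain N where "maximalideal N R" "PIdl u \<subseteq> N"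
      using exists_maximalideal_superset[OF cgenideal_ideal[OF assms(1)]] by blast
    then show False using maximal_unique assms cgenideal_self by blast
  qed
  then have "\<one> \<in> PIdl u" by simp
  then show ?thesis using mem_cgenideal_iff[OF assms(1)] by auto
qed

text \<open>Krull: \<open>mem_all_powers\<close> gives z (1 - a) = 0 with \<open>a\<close> in the
  maximal ideal, and then 1 - a is a unit.\<close>

lemma Inter_powers_zero:
  assumes K: "ideal K R" "K \<subseteq> M" and z: "z \<in> carrier R" "\<And>n. z \<in> ideal_pow R K n"
  shows "z = \<zero>"
proof -
  obtain a where a: "a \<in> K" "z = z \<otimes> a" using mem_all_powers[OF K(1) z] by blast
  have ac: "a \<in> carrier R" using a(1) ideal.Icarr[OF K(1)] by blast
  have M: "ideal M R" using maximal by (rule maximalideal.axioms(1))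
  have "\<one> \<ominus> a \<notin> M"
  proof
    assume "\<one> \<ominus> a \<in> M"
    then have "\<one> \<in> M" using ideal_diff_cancel[OF M one_closed] a(1) K(2) by blast
    then show False using ideal.one_imp_carrier[OF M] maximalideal.I_notcarr[OF maximal] by simp
  qed
  then obtain v where v: "v \<in> carrier R" "(\<one> \<ominus> a) \<otimes> v = \<one>"
    using unit_of_not_mem_maximal[of "\<one> \<ominus> a"] ac by auto
  have "z = z \<otimes> ((\<one> \<ominus> a) \<otimes> v)" using v z(1) by simp
  also have "\<dots> = (z \<ominus> z \<otimes> a) \<otimes> v" using z(1) ac v(1) by algebra
  also have "\<dots> = \<zero>" using a(2)[symmetric] z(1) v(1) by (simp add: r_neg a_minus_def)
  finally show ?thesis .
qed

text \<open>First \<open>x\<close> is shown to be a nonzerodivisor; then Artin-Rees makes the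
  intersection with I^c in the superficial condition automatic for large n.\<close>

lemma superficial_element_of_superficial:
  assumes depth: "ring_depth R M \<ge> 2" and I: "ideal I R" "primary_to R M I"
    and x: "superficial R I x"
  shows "superficial_element R I x"
proof -
  have rad: "ideal_radical R I = M" using I(2) by (simp add: primary_to_def)
  have IM: "I \<subseteq> M"
  proof
    fix a assume a: "a \<in> I"
    then have "a \<in> carrier R" using ideal.Icarr[OF I(1)] by blast
    then have "a [^] Suc 0 \<in> I" using a by simp
    then show "a \<in> M" using \<open>a \<in> carrier R\<close> unfolding rad[symmetric] ideal_radical_def by blast
  qed
  have x_mem: "x \<in> I" using x by (simp add: superficial_def)
  have xc: "x \<in> carrier R" using x_mem ideal.Icarr[OF I(1)] by blast
  obtain c where c: "\<And>n. n \<ge> c \<Longrightarrow>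
      ideal_colon R (ideal_pow R I (Suc n)) {x} \<inter> ideal_pow R I c = ideal_pow R I n"
    using x unfolding superficial_def by auto
  obtain p q where pq: "p \<in> M" "q \<in> M" "nonzerodivisor p" "q \<in> carrier R"
    "\<And>a. a \<in> carrier R \<Longrightarrow> q \<otimes> a \<in> PIdl p \<Longrightarrow> a \<in> PIdl p"
    using regular_pair_of_depth[OF depth] by blast
  have pc: "p \<in> carrier R" using pq(3) by (simp add: nonzerodivisor_def)
  obtain e f :: nat where "p [^] e \<in> I" "q [^] f \<in> I"
    using pq(1,2) unfolding rad[symmetric] ideal_radical_def by blast
  then have ef: "p [^] e \<in> ideal_pow R I (Suc 0)" "q [^] f \<in> ideal_pow R I (Suc 0)"
    unfolding ideal_pow_1[OF I(1)] .
  have pn: "p [^] (e * n) \<in> ideal_pow R I n" and qn: "q [^] (f * n) \<in> ideal_pow R I n" for n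
    using ideal_pow_elem_pow[OF I(1) ef(1), of n] ideal_pow_elem_pow[OF I(1) ef(2), of n] pc pq(4)
    by (simp_all only: nat_pow_pow mult_Suc mult_0 add_0_right)
  have grade: "\<exists>p q. p \<in> ideal_pow R I n \<and> q \<in> ideal_pow R I n \<and> nonzerodivisor p \<and>
      (\<forall>a\<in>carrier R. q \<otimes> a \<in> PIdl p \<longrightarrow> a \<in> PIdl p)" for n
    using pn[of n] qn[of n] nonzerodivisor_pow[OF pq(3)] regular_pair_pow[OF pq(3,4,5)] by blast
  have nzd: "nonzerodivisor x"
    unfolding nonzerodivisor_def
  proof (intro conjI ballI impI)
    fix z assume z: "z \<in> carrier R" "x \<otimes> z = \<zero>"
    \<comment> \<open>The factor moves \<open>z\<close> into I^c while \<open>x\<close> still kills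
      it, so superficiality puts \<open>?w\<close> into every power of \<open>I\<close>.\<close>
    let ?w = "p [^] (e * c) \<otimes> z"
    have "?w \<otimes> x = p [^] (e * c) \<otimes> (x \<otimes> z)" using z(1) xc pc by (simp add: m_ac)
    then have w: "?w \<in> carrier R" "?w \<otimes> x = \<zero>" using z pc by simp_all
    have wc: "?w \<in> ideal_pow R I c" using ideal_rmult[OF ideal_pow_ideal[OF I(1)] pn z(1)] .
    have "?w \<in> ideal_pow R I n" if "n \<ge> c" for n
    proof -
      have "?w \<in> ideal_colon R (ideal_pow R I (Suc n)) {x}"
        using w ideal_zero[OF ideal_pow_ideal[OF I(1)], of "Suc n"]
        unfolding mem_ideal_colon_iff by (simp del: nat_pow_Suc Group.nat_pow_Suc)
      then show ?thesis using c[OF that] wc by blast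
    qed
    then have "?w \<in> ideal_pow R I n" for n
      using ideal_pow_antimonoD[OF _ I(1), of ?w "max c n" n] by simp
    then have "?w = \<zero>" using Inter_powers_zero[OF I(1) IM w(1)] by blast
    then show "z = \<zero>" using nonzerodivisor_pow[OF pq(3), of "e * c"] z(1) by (simp add: nonzerodivisor_def)
  qed (rule xc)
  obtain k where k: "\<And>n z. z \<in> carrier R \<Longrightarrow> x \<otimes> z \<in> ideal_pow R I (n + k) \<Longrightarrow> z \<in> ideal_pow R I n"
    using artin_rees_nonzerodivisor[OF I(1) nzd] by blast
  have "z \<in> ideal_pow R I n"
    if n: "n \<ge> c + k" and z: "z \<in> carrier R" "x \<otimes> z \<in> ideal_pow R I (Suc n)" for n z
  proof -
    \<comment> \<open>The bound n \<ge> c + k leaves enough order for Artin-Rees to place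
      \<open>z\<close> in I^c.\<close>
    have "x \<otimes> z \<in> ideal_pow R I (c + k)" using ideal_pow_antimonoD[OF z(2) I(1)] n by simp
    then have "z \<in> ideal_pow R I c" using k z(1) by blast
    moreover have "z \<in> ideal_colon R (ideal_pow R I (Suc n)) {x}"
      using z xc unfolding mem_ideal_colon_iff by (simp add: m_comm del: nat_pow_Suc Group.nat_pow_Suc)
    ultimately show ?thesis using c[of n] n by auto
  qed
  then have "\<exists>c. \<forall>n\<ge>c. \<forall>z\<in>carrier R. x \<otimes> z \<in> ideal_pow R I (Suc n) \<longrightarrow> z \<in> ideal_pow R I n" by blast
  then show ?thesis
    using noetherian_cring_axioms I(1) x_mem grade
    by (intro superficial_element.intro superficial_element_axioms.intro) 
qed

end

section \<open>Ideals of the quotient ring\<close>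

context cring
begin

lemma ideal_pow_quot_image:
  assumes K: "ideal K R" and J: "ideal J R"
  shows "ideal_pow (R Quot K) (quot_image R K J) n = quot_image R K (ideal_pow R J n)"
proof (induct n)
  case 0
  show ?case
    using cring.ideal_pow_0[OF ideal.quotient_is_cring[OF K cring_axioms]]
    by (auto simp: quot_image_def FactRing_def A_RCOSETS_def')
next
  case (Suc n)
  interpret Q: cring "R Quot K" by (rule ideal.quotient_is_cring[OF K cring_axioms])
  interpret h: ring_hom_ring R "R Quot K" "(+>) K" by (rule ideal.rcos_ring_hom_ring[OF K])
  have img: "quot_image R K (L \<cdot> J) = quot_image R K L \<cdot>\<^bsub>R Quot K\<^esub> quot_image R K J" if L: "ideal L R" for L
  proof
    note [simp] = ideal.Icarr[OF L] ideal.Icarr[OF J]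
    have LJ: "s \<in> L \<cdot> J \<Longrightarrow> s \<in> carrier R" for s using ideal_prod_in_carrier[OF L J] by blast
    show "quot_image R K (L \<cdot> J) \<subseteq> quot_image R K L \<cdot>\<^bsub>R Quot K\<^esub> quot_image R K J"
    proof
      fix t assume "t \<in> quot_image R K (L \<cdot> J)"
      then obtain s where "s \<in> L \<cdot> J" "t = K +> s" by (auto simp: quot_image_def)
      then show "t \<in> quot_image R K L \<cdot>\<^bsub>R Quot K\<^esub> quot_image R K J"
      proof (induct s arbitrary: t rule: ideal_prod.induct)
        case (prod a b)
        then have "t = (K +> a) \<otimes>\<^bsub>R Quot K\<^esub> (K +> b)" by simp
        then show ?case using prod by (auto simp: quot_image_def intro: ideal_prod.prod)
      next
        case (sum a b)
        then have "t = (K +> a) \<oplus>\<^bsub>R Quot K\<^esub> (K +> b)" using LJ by simp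
        then show ?case using sum by (auto intro: ideal_prod.sum)
      qed
    qed
    show "quot_image R K L \<cdot>\<^bsub>R Quot K\<^esub> quot_image R K J \<subseteq> quot_image R K (L \<cdot> J)"
    proof
      fix t assume "t \<in> quot_image R K L \<cdot>\<^bsub>R Quot K\<^esub> quot_image R K J"
      then show "t \<in> quot_image R K (L \<cdot> J)"
      proof (induct t rule: ideal_prod.induct)
        case (prod s t)
        then obtain a b where ab: "a \<in> L" "b \<in> J" "s = K +> a" "t = K +> b" by (auto simp: quot_image_def)
        then have "s \<otimes>\<^bsub>R Quot K\<^esub> t = K +> a \<otimes> b" by simp
        then show ?case using ideal_prod.prod[OF ab(1,2), of R] by (auto simp: quot_image_def)
      next
        case (sum s t)
        then obtain a b where ab: "a \<in> L \<cdot> J" "b \<in> L \<cdot> J" "s = K +> a" "t = K +> b"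
          by (auto simp: quot_image_def)
        then have "s \<oplus>\<^bsub>R Quot K\<^esub> t = K +> a \<oplus> b" using LJ by simp
        then show ?case using ideal_prod.sum[OF ab(1,2)] by (auto simp: quot_image_def)
      qed
    qed
  qed
  show ?case unfolding ideal_pow_Suc Q.ideal_pow_Suc Suc img[OF ideal_pow_ideal[OF J]] ..
qed

text \<open>The sum appears because \<open>J\<close> need not contain \<open>K\<close>: powers of
  \<open>I\<close> need not contain \<open>x\<close>.\<close>

lemma mem_quot_image_iff:
  assumes "ideal K R" "ideal J R" "a \<in> carrier R"
  shows "K +> a \<in> quot_image R K J \<longleftrightarrow> a \<in> K <+> J"
proof
  assume "K +> a \<in> quot_image R K J"
  then obtain b where b: "b \<in> J" "K +> a = K +> b" by (auto simp: quot_image_def)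
  have bc: "b \<in> carrier R" using b(1) ideal.Icarr[OF assms(2)] by blast
  then have "a \<ominus> b \<in> K" using quotient_eq_iff_same_a_r_cos[OF assms(1,3)] b(2) by blast
  moreover have "a = (a \<ominus> b) \<oplus> b" using assms(3) bc by algebra
  ultimately show "a \<in> K <+> J" using b(1) set_addI by metis
next
  assume "a \<in> K <+> J"
  then obtain k b where kb: "k \<in> K" "b \<in> J" "a = k \<oplus> b" unfolding mem_set_add_iff by blast
  have c: "k \<in> carrier R" "b \<in> carrier R"
    using kb ideal.Icarr[OF assms(1)] ideal.Icarr[OF assms(2)] by blast+
  have "a \<ominus> b = k" unfolding kb(3) using c by algebra
  then have "K +> a = K +> b" using quotient_eq_iff_same_a_r_cos[OF assms(1,3) c(2)] kb(1) by simp
  then show "K +> a \<in> quot_image R K J" using kb(2) by (auto simp: quot_image_def)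
qed

end

theorem corollary7p12:
  fixes A :: "('a, 'b) ring_scheme" and \<mm> I :: "'a set" and x :: 'a
  assumes "noetherian_local_ring A \<mm>"
    and "ring_depth A \<mm> \<ge> 2"
    and "ideal I A"
    and "primary_to A \<mm> I"
    and "ratliff_rush_closed A I"
    and "asymptotically_normal A I"
    and "superficial A I x"
  shows "ideal (quot_image A (PIdl\<^bsub>A\<^esub> x) I) (A Quot (PIdl\<^bsub>A\<^esub> x)) \<and>
    ratliff_rush_closed (A Quot (PIdl\<^bsub>A\<^esub> x)) (quot_image A (PIdl\<^bsub>A\<^esub> x) I)"
proof -
  interpret A: noetherian_local_ring A \<mm> by (rule assms(1))
  interpret S: superficial_element A I x
    by (rule A.superficial_element_of_superficial[OF assms(2,3,4,7)])
  let ?K = "PIdl\<^bsub>A\<^esub> x"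
  let ?B = "A Quot ?K" and ?J = "quot_image A ?K I"
  have K: "ideal ?K A" by (rule A.cgenideal_ideal) simp
  interpret B: cring ?B by (rule ideal.quotient_is_cring[OF K A.cring_axioms])
  interpret h: ring_hom_ring A ?B "(+>\<^bsub>A\<^esub>) ?K" by (rule ideal.rcos_ring_hom_ring[OF K])
  have J: "ideal ?J ?B" unfolding quot_image_def by (rule A.ring_ideal_imp_quot_ideal[OF K assms(3)])
  obtain N where N: "\<And>n. n \<ge> N \<Longrightarrow> integrally_closed_ideal A (ideal_pow A I n)"
    using assms(6) unfolding asymptotically_normal_def by blast
  have nil: "\<exists>n::nat. t [^]\<^bsub>A\<^esub> n \<in> I" if "t \<in> \<mm>" for t
    using that assms(4) by (auto simp: primary_to_def ideal_radical_def)
  have carrier_B: "carrier ?B = quot_image A ?K (carrier A)"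
    using A.ideal_pow_quot_image[OF K assms(3), of 0] by (simp only: A.ideal_pow_0 B.ideal_pow_0)
  have "ratliff_rush_closure ?B ?J \<subseteq> ?J"
  proof
    fix b assume "b \<in> ratliff_rush_closure ?B ?J"
    then obtain j where b: "b \<in> carrier ?B"
      "\<And>k. k \<in> ideal_pow ?B ?J j \<Longrightarrow> b \<otimes>\<^bsub>?B\<^esub> k \<in> ideal_pow ?B ?J (Suc j)"
      unfolding ratliff_rush_closure_def B.mem_ideal_colon_iff by (auto simp: B.mem_ideal_colon_iff)
    obtain a where a: "a \<in> carrier A" "b = ?K +>\<^bsub>A\<^esub> a"
      using b(1) unfolding carrier_B quot_image_def by blast
    \<comment> \<open>Pulling the colon condition back to \<open>A\<close> replaces I^(j+1) by (x) +
      I^(j+1).\<close>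
    have "a \<otimes>\<^bsub>A\<^esub> w \<in> S.x_plus (Suc 0) (Suc j)" if w: "w \<in> S.I_pow j" for w
    proof -
      have wc: "w \<in> carrier A" using S.I_pow_carrier[OF w] .
      have "?K +>\<^bsub>A\<^esub> w \<in> ideal_pow ?B ?J j"
        unfolding A.ideal_pow_quot_image[OF K assms(3)] using w by (auto simp: quot_image_def)
      from b(2)[OF this] have "?K +>\<^bsub>A\<^esub> (a \<otimes>\<^bsub>A\<^esub> w) \<in> quot_image A ?K (S.I_pow (Suc j))"
        unfolding A.ideal_pow_quot_image[OF K assms(3)] a(2) using a(1) wc by simp
      then have "a \<otimes>\<^bsub>A\<^esub> w \<in> ?K <+>\<^bsub>A\<^esub> S.I_pow (Suc j)"
        unfolding A.mem_quot_image_iff[OF K S.I_pow_ideal A.m_closed[OF a(1) wc]] .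
      then show ?thesis by (simp add: A.nat_pow_Suc)
    qed
    then have "a \<in> ideal_colon A (S.x_plus (Suc 0) (Suc j)) (S.I_pow j)"
      using a(1) by (simp add: A.mem_ideal_colon_iff)
    then have "a \<in> ratliff_rush_closure A I"
      by (rule S.colon_mod_x_subset_closure[OF _ N A.maximal nil])
    then have "a \<in> I" using assms(5) by (simp add: ratliff_rush_closed_def)
    then show "b \<in> ?J" unfolding a(2) quot_image_def by blast
  qed
  moreover have "?J \<subseteq> ratliff_rush_closure ?B ?J"
  proof -
    \<comment> \<open>The index 0 of the union: the colon is by the whole quotient ring, and
      \<open>?J\<close> is an ideal.\<close>
    have "?J \<subseteq> ideal_colon ?B (ideal_pow ?B ?J (0 + 1)) (ideal_pow ?B ?J 0)"
      using B.ideal_rmult[OF J] ideal.Icarr[OF J] B.ideal_pow_1[OF J]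
      by (auto simp: B.mem_ideal_colon_iff)
    then show ?thesis unfolding ratliff_rush_closure_def by blast
  qed
  ultimately show ?thesis using J by (auto simp: ratliff_rush_closed_def)
qed

end
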